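(* Let $n\ge2$ and let $\varphi$ be a continuous function of $\tau\in[0,\infty)$ with $\lim_{\tau\to\infty}\varphi(\tau)=\infty$. Let $\Omega$ be a domain of the Heisenberg group $H_n$ (with coordinates $x_1,\dots,x_{2n},z$) defined by either $z>\varphi\big(\sqrt{x_1^2+\dots+x_{2n}^2}\big)$ or $x_1>\varphi\big(\sqrt{x_2^2+\dots+x_{2n}^2+z^2}\big)$. Then there does not exist any horizontal ($p$-)minimal hypersurface properly immersed in $\Omega$.
   Context: $H_n=\mathbb{R}^{2n+1}$ with contact form $\Theta=dz+\sum_{j=1}^n(x_jdx_{n+j}-x_{n+j}dx_j)$ and horizontal orthonormal frame $\hat e_j=\partial_{x_j}+x_{n+j}\partial_z$, $\hat e_{n+j}=\partial_{x_{n+j}}-x_j\partial_z$ ($1\le j\le n$) spanning $\xi=\ker\Theta$. For a hypersurface $\Sigma$ with (local) defining function $\phi$, a point is singular if $\xi=T\Sigma$ there, and at nonsingular points the horizontal ($p$-)mean curvature is $H_\Sigma=\sum_{I=1}^{2n}\hat e_I\big(\hat e_I\phi/(\sum_K(\hat e_K\phi)^2)^{1/2}\big)$. $\Sigma$ is horizontally ($p$-)minimal if $H_\Sigma=0$ at all nonsingular points.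
   Formalization: "Properly immersed in Ω" is taken as: contained in Ω and proper as an immersion into H_n; if proper only relative to Ω, the claim fails, since the slices {z=c}∩Ω (respectively {x_1=c}∩Ω) with c>φ(0) are p-minimal and closed in Ω. *)

theory Defs
  imports "HOL-Analysis.Analysis"
begin

text \<open>
  A point of $H_n$ is a pair (x, z), where n is the cardinality of 'n. For j :: 'n the coordinate
  $x_j$ is \<open>x $ Inl j\<close> and $x_{n+j}$ is \<open>x $ Inr j\<close>.
\<close>

type_synonym 'n heisenberg = "(real ^ ('n + 'n)) \<times> real"

definition contact_form :: "'n::finite heisenberg \<Rightarrow> 'n heisenberg \<Rightarrow> real" where
  "contact_form q v =
     snd v + (\<Sum>j\<in>UNIV. fst q $ Inl j * fst v $ Inr j - fst q $ Inr j * fst v $ Inl j)"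

definition contact_plane :: "'n::finite heisenberg \<Rightarrow> 'n heisenberg set" where
  "contact_plane q = {v. contact_form q v = 0}"

fun hframe :: "'n::finite + 'n \<Rightarrow> 'n heisenberg \<Rightarrow> 'n heisenberg" where
  "hframe (Inl j) q = (axis (Inl j) 1, fst q $ Inr j)"
| "hframe (Inr j) q = (axis (Inr j) 1, - (fst q $ Inl j))"

definition hderiv :: "'n::finite + 'n \<Rightarrow> ('n heisenberg \<Rightarrow> real) \<Rightarrow> 'n heisenberg \<Rightarrow> real" where
  "hderiv I \<phi> q = frechet_derivative \<phi> (at q) (hframe I q)"

definition hgrad_norm :: "('n::finite heisenberg \<Rightarrow> real) \<Rightarrow> 'n heisenberg \<Rightarrow> real" where
  "hgrad_norm \<phi> q = sqrt (\<Sum>K\<in>UNIV. (hderiv K \<phi> q)\<^sup>2)"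

definition hmean_curvature :: "('n::finite heisenberg \<Rightarrow> real) \<Rightarrow> 'n heisenberg \<Rightarrow> real" where
  "hmean_curvature \<phi> q = (\<Sum>I\<in>UNIV. hderiv I (\<lambda>r. hderiv I \<phi> r / hgrad_norm \<phi> r) q)"

definition C2_on :: "('a::real_normed_vector \<Rightarrow> 'b::real_normed_vector) \<Rightarrow> 'a set \<Rightarrow> bool" where
  "C2_on f S \<longleftrightarrow> open S \<and>
     (\<exists>(f' :: 'a \<Rightarrow> 'a \<Rightarrow>\<^sub>L 'b) (f'' :: 'a \<Rightarrow> 'a \<Rightarrow>\<^sub>L ('a \<Rightarrow>\<^sub>L 'b)).
        (\<forall>x\<in>S. (f has_derivative blinfun_apply (f' x)) (at x)) \<and>
        (\<forall>x\<in>S. (f' has_derivative blinfun_apply (f'' x)) (at x)) \<and>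
        continuous_on S f'')"

definition C2_atlas :: "'m topology \<Rightarrow> ('m set \<times> ('m \<Rightarrow> 'e::euclidean_space)) set \<Rightarrow> bool" where
  "C2_atlas M A \<longleftrightarrow>
     (\<Union>(U, c)\<in>A. U) = topspace M \<and>
     (\<forall>(U, c)\<in>A. openin M U \<and> open (c ` U) \<and>
        homeomorphic_map (subtopology M U) (top_of_set (c ` U)) c) \<and>
     (\<forall>(U, c)\<in>A. \<forall>(V, d)\<in>A. C2_on (d \<circ> inv_into U c) (c ` (U \<inter> V)))"

definition C2_manifold :: "'m topology \<Rightarrow> ('m set \<times> ('m \<Rightarrow> 'e::euclidean_space)) set \<Rightarrow> bool" where
  "C2_manifold M A \<longleftrightarrow> Hausdorff_space M \<and> second_countable M \<and> C2_atlas M A"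

definition C2_immersion ::
    "('m set \<times> ('m \<Rightarrow> 'e::euclidean_space)) set \<Rightarrow> ('m \<Rightarrow> 'b::euclidean_space) \<Rightarrow> bool" where
  "C2_immersion A F \<longleftrightarrow>
     (\<forall>(U, c)\<in>A. C2_on (F \<circ> inv_into U c) (c ` U) \<and>
        (\<forall>x\<in>c ` U. inj (frechet_derivative (F \<circ> inv_into U c) (at x))))"

text \<open>
  Hypersurfaces are nonempty and without boundary, but need not be connected. Properness refers to
  the map into the whole Heisenberg group, not into \<open>\<Omega>\<close>: the part of a plane z = c inside \<open>\<Omega>\<close> is
  horizontally minimal and relatively closed in \<open>\<Omega>\<close>.
\<close>

definition properly_immersed_hypersurface ::
    "'m topology \<Rightarrow> ('m set \<times> ('m \<Rightarrow> real ^ ('n::finite + 'n))) set \<Rightarrow> ('m \<Rightarrow> 'n heisenberg) \<Rightarrow>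
     'n heisenberg set \<Rightarrow> bool" where
  "properly_immersed_hypersurface M A F \<Omega> \<longleftrightarrow>
     topspace M \<noteq> {} \<and> C2_manifold M A \<and> C2_immersion A F \<and>
     F ` topspace M \<subseteq> \<Omega> \<and> proper_map M euclidean F"

text \<open>
  \<open>\<phi>\<close> defines the sheet of the immersed hypersurface through p. Other sheets may pass through
  the same neighbourhood V of F p, which is why the zero set is compared with F ` U only.
\<close>

definition local_defining_function ::
    "'m topology \<Rightarrow> ('m \<Rightarrow> 'n::finite heisenberg) \<Rightarrow> 'm \<Rightarrow> ('n heisenberg \<Rightarrow> real) \<Rightarrow> bool" where
  "local_defining_function M F p \<phi> \<longleftrightarrow>
     (\<exists>U V. openin M U \<and> p \<in> U \<and> inj_on F U \<and> C2_on \<phi> V \<and>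
        F ` U = {q \<in> V. \<phi> q = 0} \<and>
        (\<forall>q\<in>F ` U. frechet_derivative \<phi> (at q) \<noteq> (\<lambda>v. 0)))"

text \<open>The kernel of the derivative of \<open>\<phi>\<close> at q is the tangent space of its level set at q.\<close>

definition singular_at :: "('n::finite heisenberg \<Rightarrow> real) \<Rightarrow> 'n heisenberg \<Rightarrow> bool" where
  "singular_at \<phi> q \<longleftrightarrow> contact_plane q = {v. frechet_derivative \<phi> (at q) v = 0}"

definition horizontally_minimal :: "'m topology \<Rightarrow> ('m \<Rightarrow> 'n::finite heisenberg) \<Rightarrow> bool" where
  "horizontally_minimal M F \<longleftrightarrow>
     (\<forall>p\<in>topspace M. \<forall>\<phi>. local_defining_function M F p \<phi> \<longrightarrow>
        \<not> singular_at \<phi> (F p) \<longrightarrow> hmean_curvature \<phi> (F p) = 0)"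

definition upper_domain :: "(real \<Rightarrow> real) \<Rightarrow> 'n::finite heisenberg set" where
  "upper_domain \<phi> = {(x, z). z > \<phi> (sqrt (\<Sum>I\<in>UNIV. (x $ I)\<^sup>2))}"

text \<open>The index k :: 'n plays the role of 1, since 'n has no distinguished element.\<close>

definition side_domain :: "'n::finite \<Rightarrow> (real \<Rightarrow> real) \<Rightarrow> 'n heisenberg set" where
  "side_domain k \<phi> =
     {(x, z). x $ Inl k > \<phi> (sqrt ((\<Sum>I\<in>UNIV - {Inl k}. (x $ I)\<^sup>2) + z\<^sup>2))}"

end

(*
  The function f = l + 1 / (1 + r), where l = z and r = |(x_1, ..., x_2n)| for the first domain and
  l = x_1 and r = |(x_2, ..., x_2n)| for the second one, has bounded sublevel sets in the domain, so
  it attains a minimum on the closed image of a properly immersed hypersurface.  At a minimum with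
  r > 0 the hypersurface touches a level set of f from one side; there the level set is
  nonsingular and, since n >= 2, its mean curvature is strictly negative, which the comparison
  of second derivatives excludes for a minimal hypersurface.  A minimum with r = 0 is excluded since
  f has a concave kink there: a hypersurface with this minimum would have a tangent space inside
  dl = 0, dr = 0, which is too small.  So the kink keeps the touching point away from the singular
  points of the level sets, where minimality gives no information.
*)

theory Submission
  imports Defs
begin

subsection \<open>The inverse function theorem in class C2\<close>

text \<open>The levels of l alone give no contradiction: z = c and x_1 = c are horizontally minimal
  themselves, and z = c is singular at x = 0. The added term makes the comparison strict and stays
  between 0 and 1, so sublevel sets remain bounded. With psi(r) = 1 / (1 + r) the proof uses psi' <
  0 down to r = 0, where it causes the kink, and psi'' <= -2 psi' / r. The radius leaves out z
  because the frame projects to the coordinate axes of the x space, so that frame derivatives of r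
  are Euclidean; the price is that r = 0 is a set and not a point. If r involves s coordinates, the
  trace of the second derivative is psi'' + (s - 1) psi' / r <= (s - 3) psi' / r. In the first case
  s = 2n and one further unit is lost to the gradient of z, in the second s = 2n - 1 and nothing
  more is lost; both times n >= 2 is what remains to be asked. Minimality is phrased by defining
  functions of class C2, while a surface is given by parametrisations. An inverse function theorem
  of class C2 bridges the two.\<close>

lift_definition blinfun_compose_left ::
  "('b::real_normed_vector \<Rightarrow>\<^sub>L 'c::real_normed_vector) \<Rightarrow> ('a::real_normed_vector \<Rightarrow>\<^sub>L 'b) \<Rightarrow>\<^sub>L ('a \<Rightarrow>\<^sub>L 'c)"
  is "\<lambda>B A. B o\<^sub>L A"
  by (rule bounded_bilinear.bounded_linear_right[OF bounded_bilinear_blinfun_compose])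

lift_definition blinfun_compose_right ::
  "('a::real_normed_vector \<Rightarrow>\<^sub>L 'b::real_normed_vector) \<Rightarrow> ('b \<Rightarrow>\<^sub>L 'c::real_normed_vector) \<Rightarrow>\<^sub>L ('a \<Rightarrow>\<^sub>L 'c)"
  is "\<lambda>B A. A o\<^sub>L B"
  by (rule bounded_bilinear.bounded_linear_left[OF bounded_bilinear_blinfun_compose])

declare blinfun_compose_left.rep_eq [simp] blinfun_compose_right.rep_eq [simp]

lemma bounded_linear_blinfun_compose_left [bounded_linear]:
  "bounded_linear (blinfun_compose_left ::
    ('b::real_normed_vector \<Rightarrow>\<^sub>L 'c::real_normed_vector) \<Rightarrow> ('a::real_normed_vector \<Rightarrow>\<^sub>L 'b) \<Rightarrow>\<^sub>L _)"
proof (rule bounded_linear_intro[where K=1])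
  show "norm (blinfun_compose_left x :: ('a \<Rightarrow>\<^sub>L 'b) \<Rightarrow>\<^sub>L _) \<le> norm x * 1" for x :: "'b \<Rightarrow>\<^sub>L 'c"
    by (rule norm_blinfun_bound) (simp_all add: norm_blinfun_compose)
qed (auto intro!: blinfun_eqI simp: blinfun.bilinear_simps)

lemma bounded_linear_blinfun_compose_right [bounded_linear]:
  "bounded_linear (blinfun_compose_right ::
    ('a::real_normed_vector \<Rightarrow>\<^sub>L 'b::real_normed_vector) \<Rightarrow> ('b \<Rightarrow>\<^sub>L 'c::real_normed_vector) \<Rightarrow>\<^sub>L _)"
proof (rule bounded_linear_intro[where K=1])
  show "norm (blinfun_compose_right x :: ('b \<Rightarrow>\<^sub>L 'c) \<Rightarrow>\<^sub>L _) \<le> norm x * 1" for x :: "'a \<Rightarrow>\<^sub>L 'b"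
    by (rule norm_blinfun_bound) (simp, metis blinfun_compose_right.rep_eq mult.commute mult.right_neutral norm_blinfun_compose)
qed (auto intro!: blinfun_eqI simp: blinfun.bilinear_simps)

text \<open>Only the pointwise identities \<open>left\<close> and \<open>right\<close> tie
  \<open>G\<close> to \<open>A\<close>, so boundedness near \<open>y0\<close>, continuity and
  differentiability are won in this order, each from the resolvent identity for the difference of
  two inverses.\<close>

lemma blinfun_inverse_has_derivative:
  fixes A :: "'x::real_normed_vector \<Rightarrow> 'a::real_normed_vector \<Rightarrow>\<^sub>L 'b::real_normed_vector"
    and G :: "'x \<Rightarrow> 'b \<Rightarrow>\<^sub>L 'a"
  assumes V: "open V" "y0 \<in> V"
    and left: "\<And>y. y \<in> V \<Longrightarrow> G y o\<^sub>L A y = id_blinfun"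
    and right: "\<And>y. y \<in> V \<Longrightarrow> A y o\<^sub>L G y = id_blinfun"
    and A: "(A has_derivative A') (at y0)"
  shows "(G has_derivative (\<lambda>h. - (G y0 o\<^sub>L A' h o\<^sub>L G y0))) (at y0)"
proof -
  define G0 where "G0 = G y0"
  have ev: "\<forall>\<^sub>F y in at y0. y \<in> V"
    using V by (simp add: eventually_at_topological) blast
  have L: "G y (A y v) = v" if "y \<in> V" for y v
    using left[OF that] by (metis blinfun_apply_blinfun_compose blinfun_apply_id_blinfun id_apply)
  have R: "A y (G y v) = v" if "y \<in> V" for y v
    using right[OF that] by (metis blinfun_apply_blinfun_compose blinfun_apply_id_blinfun id_apply)
  have diff: "G y - G0 = - (G y o\<^sub>L (A y - A y0) o\<^sub>L G0)" if "y \<in> V" for y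
    using that V by (auto intro!: blinfun_eqI simp: blinfun.bilinear_simps L R G0_def)
  have At: "(A \<longlongrightarrow> A y0) (at y0)"
    using has_derivative_continuous[OF A] by (simp add: continuous_within)
  have comp3: "norm (P o\<^sub>L Q o\<^sub>L S) \<le> norm P * norm Q * norm S"
    for P :: "'b \<Rightarrow>\<^sub>L 'a" and Q :: "'a \<Rightarrow>\<^sub>L 'b" and S :: "'b \<Rightarrow>\<^sub>L 'a"
    by (meson norm_blinfun_compose mult_right_mono norm_ge_zero order_trans)
  \<comment> \<open>Near \<open>y0\<close> the resolvent identity bounds
    \<open>norm (G y - G0)\<close> by half of \<open>norm (G y)\<close>; the triangle inequality
    absorbs this, whence the factor 2.\<close>
  have bound: "\<forall>\<^sub>F y in at y0. norm (G y) \<le> 2 * norm G0"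
  proof -
    have "((\<lambda>y. norm (A y - A y0) * norm G0) \<longlongrightarrow> norm (A y0 - A y0) * norm G0) (at y0)"
      by (intro tendsto_intros At)
    then have "\<forall>\<^sub>F y in at y0. norm (A y - A y0) * norm G0 < 1/2"
      by (intro order_tendstoD(2)) auto
    with ev show ?thesis
    proof eventually_elim
      case (elim y)
      have "norm (G y - G0) \<le> norm (G y) * norm (A y - A y0) * norm G0"
        using comp3 diff[OF elim(1)] by simp
      also have "\<dots> \<le> norm (G y) * (1/2)"
        unfolding mult.assoc using elim by (intro mult_left_mono) auto
      finally have "norm (G y - G0) \<le> norm (G y) * (1/2)" .
      moreover have "norm (G y) \<le> norm (G y - G0) + norm G0"
        by (metis add.commute diff_add_cancel norm_triangle_ineq)
      ultimately show ?case by simp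
    qed
  qed
  have Gt: "(G \<longlongrightarrow> G0) (at y0)"
  proof (rule LIM_zero_cancel, rule tendsto_norm_zero_cancel, rule real_tendsto_sandwich)
    show "\<forall>\<^sub>F y in at y0. 0 \<le> norm (G y - G0)" by simp
    show "\<forall>\<^sub>F y in at y0. norm (G y - G0) \<le> 2 * norm G0 * norm (A y - A y0) * norm G0"
      using ev bound
    proof eventually_elim
      case (elim y)
      have "norm (G y - G0) \<le> norm (G y) * norm (A y - A y0) * norm G0"
        using comp3 diff[OF elim(1)] by simp
      also have "\<dots> \<le> 2 * norm G0 * norm (A y - A y0) * norm G0"
        using elim by (intro mult_right_mono) auto
      finally show ?case .
    qed
    have "((\<lambda>y. 2 * norm G0 * norm (A y - A y0) * norm G0) \<longlongrightarrow> 2 * norm G0 * norm (A y0 - A y0) * norm G0) (at y0)"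
      by (intro tendsto_intros At)
    then show "((\<lambda>y. 2 * norm G0 * norm (A y - A y0) * norm G0) \<longlongrightarrow> 0) (at y0)"
      by simp
  qed auto
  have A': "bounded_linear A'"
    and At': "((\<lambda>y. norm (A y - A y0 - A' (y - y0)) / norm (y - y0)) \<longlongrightarrow> 0) (at y0)"
    using A by (auto simp: has_derivative_iff_norm)
  obtain K where K: "\<And>x. norm (A' x) \<le> norm x * K"
    using bounded_linear.bounded[OF A'] by blast
  have "((\<lambda>y. norm (G y - G y0 - - (G y0 o\<^sub>L A' (y - y0) o\<^sub>L G y0)) / norm (y - y0)) \<longlongrightarrow> 0) (at y0)"
  proof (rule real_tendsto_sandwich[where f="\<lambda>_. 0"])
    let ?b = "\<lambda>y. norm (G y) * (norm (A y - A y0 - A' (y - y0)) / norm (y - y0)) * norm G0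
      + norm (G y - G0) * K * norm G0"
    show "\<forall>\<^sub>F y in at y0. norm (G y - G y0 - - (G y0 o\<^sub>L A' (y - y0) o\<^sub>L G y0)) / norm (y - y0) \<le> ?b y"
      using ev eventually_neq_at_within[of y0 y0 UNIV]
    proof eventually_elim
      case (elim y)
      let ?h = "y - y0"
      \<comment> \<open>Replacing \<open>G y\<close> by \<open>G0\<close> in the main term of the
        resolvent identity leaves two errors: the remainder of \<open>A\<close>, and
        \<open>G y - G0\<close> times a term linear in \<open>?h\<close>.\<close>
      have "G y - G y0 - - (G y0 o\<^sub>L A' ?h o\<^sub>L G y0)
        = - (G y o\<^sub>L (A y - A y0 - A' ?h) o\<^sub>L G0) - ((G y - G0) o\<^sub>L A' ?h o\<^sub>L G0)"
        using elim V by (auto intro!: blinfun_eqI simp: blinfun.bilinear_simps L R G0_def)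
      then have "norm (G y - G y0 - - (G y0 o\<^sub>L A' ?h o\<^sub>L G y0))
        \<le> norm (G y o\<^sub>L (A y - A y0 - A' ?h) o\<^sub>L G0) + norm ((G y - G0) o\<^sub>L A' ?h o\<^sub>L G0)"
        by (metis norm_minus_cancel norm_triangle_ineq4)
      also have "\<dots> \<le> norm (G y) * norm (A y - A y0 - A' ?h) * norm G0 + norm (G y - G0) * norm (A' ?h) * norm G0"
        by (intro add_mono comp3)
      also have "\<dots> \<le> norm (G y) * norm (A y - A y0 - A' ?h) * norm G0 + norm (G y - G0) * (norm ?h * K) * norm G0"
        by (intro add_left_mono mult_right_mono mult_left_mono K) auto
      also have "\<dots> = ?b y * norm ?h"
        using elim by (simp add: field_simps)
      finally show ?case
        using elim by (simp add: pos_divide_le_eq)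
    qed
    have "(?b \<longlongrightarrow> norm G0 * 0 * norm G0 + norm (G0 - G0) * K * norm G0) (at y0)"
      by (intro tendsto_intros Gt At')
    then show "(?b \<longlongrightarrow> 0) (at y0)" by simp
  qed auto
  moreover have "bounded_linear (\<lambda>h. - (G y0 o\<^sub>L A' h o\<^sub>L G y0))"
    by (intro bounded_linear_minus
        bounded_linear_compose[OF bounded_bilinear.bounded_linear_left[OF bounded_bilinear_blinfun_compose]]
        bounded_linear_compose[OF bounded_bilinear.bounded_linear_right[OF bounded_bilinear_blinfun_compose]] A')
  ultimately show ?thesis
    by (simp add: has_derivative_iff_norm)
qed

text \<open>The theorem in class C1 gives \<open>g\<close> whose derivative at y is the inverse of
  \<open>f' (g y)\<close>. Inversion being differentiable, \<open>g'\<close> is differentiable, with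
  a derivative built from continuous factors.\<close>

lemma C2_inverse_function:
  fixes f :: "'a::euclidean_space \<Rightarrow> 'a"
  assumes U: "open U" "x0 \<in> U"
    and f: "\<And>x. x \<in> U \<Longrightarrow> (f has_derivative blinfun_apply (f' x)) (at x)"
    and f': "\<And>x. x \<in> U \<Longrightarrow> (f' has_derivative blinfun_apply (f'' x)) (at x)"
    and cont: "continuous_on U f''"
    and inj: "inj (blinfun_apply (f' x0))"
  obtains U' V g g' g'' where "open U'" "U' \<subseteq> U" "x0 \<in> U'" "open V" "homeomorphism U' V f g"
    "\<And>y. y \<in> V \<Longrightarrow> (g has_derivative blinfun_apply (g' y)) (at y)"
    "\<And>y. y \<in> V \<Longrightarrow> (g' has_derivative blinfun_apply (g'' y)) (at y)"
    "continuous_on V g''"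
    "\<And>y. y \<in> V \<Longrightarrow> g' y o\<^sub>L f' (g y) = id_blinfun"
    "\<And>y. y \<in> V \<Longrightarrow> f' (g y) o\<^sub>L g' y = id_blinfun"
proof -
  have contf': "continuous_on U f'"
    by (meson f' has_derivative_continuous continuous_at_imp_continuous_on)
  obtain h where h: "linear h" "h \<circ> blinfun_apply (f' x0) = id"
    using linear_injective_left_inverse[OF bounded_linear.linear[OF blinfun.bounded_linear_right] inj] by blast
  have "Blinfun h o\<^sub>L f' x0 = id_blinfun"
    using h by (intro blinfun_eqI) (auto simp: bounded_linear_Blinfun_apply linear_conv_bounded_linear fun_eq_iff)
  from inverse_function_theorem[OF U(1) f contf' U(2) this]
  obtain U' V g d where U': "open U'" "U' \<subseteq> U" "x0 \<in> U'" and V: "open V" and hom: "homeomorphism U' V f g"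
    and g: "\<And>y. y \<in> V \<Longrightarrow> (g has_derivative d y) (at y)"
    and d: "\<And>y. y \<in> V \<Longrightarrow> d y = inv (blinfun_apply (f' (g y)))"
    and bij: "\<And>y. y \<in> V \<Longrightarrow> bij (blinfun_apply (f' (g y)))"
    by metis
  define g' where "g' y = Blinfun (d y)" for y
  have g'_app: "blinfun_apply (g' y) = d y" if "y \<in> V" for y
    using g[OF that] by (auto simp: g'_def bounded_linear_Blinfun_apply dest: has_derivative_bounded_linear)
  have left: "g' y o\<^sub>L f' (g y) = id_blinfun" if "y \<in> V" for y
    using bij[OF that] by (auto intro!: blinfun_eqI simp: g'_app that d bij_is_inj)
  have right: "f' (g y) o\<^sub>L g' y = id_blinfun" if "y \<in> V" for y
    using bij[OF that] by (auto intro!: blinfun_eqI simp: g'_app that d bij_is_surj surj_f_inv_f)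
  have gU: "g y \<in> U" if "y \<in> V" for y
    using hom that U' by (auto simp: homeomorphism_def)
  \<comment> \<open>This sends h to minus
    \<open>g' y o\<^sub>L f'' (g y) (g' y h) o\<^sub>L g' y\<close>. It is written as a composition
    of bounded operators so that continuity in \<open>y\<close> follows factor by factor.\<close>
  define g'' where "g'' y = - (blinfun_compose_left (g' y) o\<^sub>L blinfun_compose_right (g' y) o\<^sub>L f'' (g y) o\<^sub>L g' y)" for y
  have g1: "(g has_derivative blinfun_apply (g' y)) (at y)" if "y \<in> V" for y
    using g[OF that] by (simp add: g'_app that)
  have g2: "(g' has_derivative blinfun_apply (g'' y)) (at y)" if "y \<in> V" for y
  proof -
    have "((\<lambda>y. f' (g y)) has_derivative (\<lambda>h. f'' (g y) (g' y h))) (at y)"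
      by (rule has_derivative_compose[OF g1[OF that] f'[OF gU[OF that]]])
    from blinfun_inverse_has_derivative[OF V that left right this]
    have "(g' has_derivative (\<lambda>h. - (g' y o\<^sub>L f'' (g y) (g' y h) o\<^sub>L g' y))) (at y)" .
    moreover have "(\<lambda>h. - (g' y o\<^sub>L f'' (g y) (g' y h) o\<^sub>L g' y)) = blinfun_apply (g'' y)"
      by (auto intro!: blinfun_eqI simp: g''_def blinfun.bilinear_simps fun_eq_iff)
    ultimately show ?thesis by simp
  qed
  have cg': "continuous_on V g'"
    by (meson g2 has_derivative_continuous continuous_at_imp_continuous_on)
  have cg: "continuous_on V g"
    using hom by (simp add: homeomorphism_def)
  have "continuous_on V (\<lambda>y. f'' (g y))"
    by (rule continuous_on_compose2[OF cont cg]) (auto simp: gU)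
  then have "continuous_on V g''"
    unfolding g''_def
    by (intro continuous_intros cg' bounded_bilinear.continuous_on[OF bounded_bilinear_blinfun_compose]
        bounded_linear.continuous_on[OF bounded_linear_blinfun_compose_left]
        bounded_linear.continuous_on[OF bounded_linear_blinfun_compose_right])
  from that[OF U' V hom g1 g2 this left right] show thesis .
qed

subsection \<open>Local equations of immersed hypersurfaces\<close>

text \<open>The immersion is thickened along a fixed vector \<nu> outside the tangent space: (x, t)
  -> F x + t \<nu> is a local diffeomorphism, and the t component of its inverse is the equation.
  The tangent space is recorded both as a kernel and as a range because the touching argument passes
  from one to the other.\<close>

lemma immersed_hypersurface_local_equation:
  fixes F :: "'e::euclidean_space \<Rightarrow> 'e \<times> real"
  assumes W: "open W" "x0 \<in> W"
    and F: "\<And>x. x \<in> W \<Longrightarrow> (F has_derivative blinfun_apply (F' x)) (at x)"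
    and F': "\<And>x. x \<in> W \<Longrightarrow> (F' has_derivative blinfun_apply (F'' x)) (at x)"
    and cont: "continuous_on W F''"
    and inj: "inj (blinfun_apply (F' x0))"
  obtains S V and \<phi> :: "'e \<times> real \<Rightarrow> real" and \<phi>' \<phi>'' where "open S" "x0 \<in> S" "S \<subseteq> W" "inj_on F S" "open V"
    "F ` S = {q \<in> V. \<phi> q = 0}"
    "\<And>q. q \<in> V \<Longrightarrow> (\<phi> has_derivative blinfun_apply (\<phi>' q)) (at q)"
    "\<And>q. q \<in> V \<Longrightarrow> (\<phi>' has_derivative blinfun_apply (\<phi>'' q)) (at q)"
    "continuous_on V \<phi>''"
    "\<And>q. q \<in> V \<Longrightarrow> \<phi>' q \<noteq> 0"
    "{v. \<phi>' (F x0) v = 0} = range (blinfun_apply (F' x0))"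
proof -
  let ?T = "range (blinfun_apply (F' x0))"
  have lin: "linear (blinfun_apply (F' x0))"
    by (rule bounded_linear.linear[OF blinfun.bounded_linear_right])
  have subT: "subspace ?T"
    by (rule linear_subspace_image[OF lin subspace_UNIV])
  have "dim ?T \<le> DIM('e)"
    using dim_image_le[OF lin, of UNIV] by simp
  then have "?T \<noteq> UNIV"
    by (metis DIM_prod DIM_real add.commute dim_UNIV not_less_eq_eq order_refl plus_1_eq_Suc)
  then obtain \<nu> where \<nu>: "\<nu> \<notin> ?T" by blast
  have \<nu>_zero: "t = 0" if "t *\<^sub>R \<nu> \<in> ?T" for t
    using subspace_scale[OF subT that, of "inverse t"] \<nu> by (cases "t = 0") auto
  define \<Phi> where "\<Phi> p = F (fst p) + snd p *\<^sub>R \<nu>" for p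
  define \<Phi>' where "\<Phi>' p = (F' (fst p) o\<^sub>L fst_blinfun) + (blinfun_scaleR_left \<nu> o\<^sub>L snd_blinfun)" for p :: "'e \<times> real"
  define \<Phi>'' :: "'e \<times> real \<Rightarrow> ('e \<times> real) \<Rightarrow>\<^sub>L ('e \<times> real) \<Rightarrow>\<^sub>L ('e \<times> real)" where "\<Phi>'' p = blinfun_compose_right fst_blinfun o\<^sub>L F'' (fst p) o\<^sub>L fst_blinfun"
    for p :: "'e \<times> real"
  have d1: "(\<Phi> has_derivative blinfun_apply (\<Phi>' p)) (at p)" if "p \<in> W \<times> UNIV" for p
  proof -
    have "((\<lambda>p. F (fst p)) has_derivative (\<lambda>h. F' (fst p) (fst h))) (at p)"
      by (rule has_derivative_compose[OF has_derivative_fst[OF has_derivative_ident] F]) (use that in auto)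
    then have "((\<lambda>p. F (fst p) + snd p *\<^sub>R \<nu>) has_derivative (\<lambda>h. F' (fst p) (fst h) + snd h *\<^sub>R \<nu>)) (at p)"
      by (auto intro!: derivative_eq_intros)
    then show ?thesis
      unfolding \<Phi>_def by (rule has_derivative_eq_rhs) (simp add: \<Phi>'_def blinfun.bilinear_simps fun_eq_iff)
  qed
  have d2: "(\<Phi>' has_derivative blinfun_apply (\<Phi>'' p)) (at p)" if "p \<in> W \<times> UNIV" for p
  proof -
    have "((\<lambda>p. F' (fst p)) has_derivative (\<lambda>h. F'' (fst p) (fst h))) (at p)"
      by (rule has_derivative_compose[OF has_derivative_fst[OF has_derivative_ident] F']) (use that in auto)
    then have "((\<lambda>p. blinfun_compose_right fst_blinfun (F' (fst p)) + (blinfun_scaleR_left \<nu> o\<^sub>L snd_blinfun))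
      has_derivative (\<lambda>h. blinfun_compose_right fst_blinfun (F'' (fst p) (fst h)) + 0)) (at p)"
      by (intro has_derivative_add has_derivative_const bounded_linear.has_derivative[OF blinfun.bounded_linear_right])
    then show ?thesis
      unfolding \<Phi>'_def blinfun_compose_right.rep_eq by (rule has_derivative_eq_rhs) (simp add: \<Phi>''_def fun_eq_iff)
  qed
  have cont\<Phi>: "continuous_on (W \<times> UNIV) \<Phi>''"
    unfolding \<Phi>''_def
    by (intro bounded_bilinear.continuous_on[OF bounded_bilinear_blinfun_compose] continuous_on_const
        continuous_on_compose2[OF cont] continuous_intros) auto
  have inj\<Phi>: "inj (blinfun_apply (\<Phi>' (x0, 0)))"
  proof -
    have "v = 0" if "\<Phi>' (x0, 0) v = 0" for v
    proof -
      have eq: "F' x0 (fst v) + snd v *\<^sub>R \<nu> = 0"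
        using that by (simp add: \<Phi>'_def blinfun.bilinear_simps)
      then have "snd v *\<^sub>R \<nu> = F' x0 (- fst v)"
        by (simp add: blinfun.bilinear_simps add_eq_0_iff)
      then have "snd v = 0" by (intro \<nu>_zero) auto
      moreover with eq have "F' x0 (fst v) = F' x0 0"
        by (simp add: blinfun.bilinear_simps)
      then have "fst v = 0" using inj by (meson injD)
      ultimately show ?thesis by (simp add: prod_eq_iff)
    qed
    then show ?thesis
      using linear_injective_0[OF bounded_linear.linear[OF blinfun.bounded_linear_right]] by blast
  qed
  have "open (W \<times> (UNIV :: real set))" "(x0, 0) \<in> W \<times> (UNIV :: real set)"
    using W by (auto intro: open_Times)
  from C2_inverse_function[OF this d1 d2 cont\<Phi> inj\<Phi>]
  obtain U' V g g' g'' where U': "open U'" "U' \<subseteq> W \<times> UNIV" "(x0, 0) \<in> U'" and V: "open V"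
    and hom: "homeomorphism U' V \<Phi> g"
    and g1: "\<And>y. y \<in> V \<Longrightarrow> (g has_derivative blinfun_apply (g' y)) (at y)"
    and g2: "\<And>y. y \<in> V \<Longrightarrow> (g' has_derivative blinfun_apply (g'' y)) (at y)"
    and cg: "continuous_on V g''"
    and left: "\<And>y. y \<in> V \<Longrightarrow> g' y o\<^sub>L \<Phi>' (g y) = id_blinfun"
    and right: "\<And>y. y \<in> V \<Longrightarrow> \<Phi>' (g y) o\<^sub>L g' y = id_blinfun"
    by metis
  have g\<Phi>: "g (\<Phi> p) = p" "\<Phi> p \<in> V" if "p \<in> U'" for p
    using hom that by (auto simp: homeomorphism_def)
  have \<Phi>g: "\<Phi> (g q) = q" "g q \<in> U'" if "q \<in> V" for q
    using hom that by (auto simp: homeomorphism_def)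
  \<comment> \<open>\<open>S\<close> is the slice t = 0 of all of \<open>U'\<close>, so no zero of
    \<open>\<phi>\<close> in \<open>V\<close> is missed.\<close>
  define S where "S = (\<lambda>x. (x, 0::real)) -` U'"
  define \<phi> where "\<phi> q = snd (g q)" for q
  define \<phi>' where "\<phi>' q = snd_blinfun o\<^sub>L g' q" for q
  define \<phi>'' where "\<phi>'' q = blinfun_compose_left snd_blinfun o\<^sub>L g'' q" for q
  have F\<Phi>: "F x = \<Phi> (x, 0)" for x
    by (simp add: \<Phi>_def)
  show thesis
  proof
    show "open S"
      unfolding S_def by (intro open_vimage U' continuous_intros)
    show "x0 \<in> S" "S \<subseteq> W" using U' by (auto simp: S_def)
    show "inj_on F S"
      by (rule inj_on_inverseI[where g="fst \<circ> g"]) (simp add: S_def F\<Phi> g\<Phi>)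
    show "open V" by fact
    show "F ` S = {q \<in> V. \<phi> q = 0}"
    proof (intro equalityI subsetI)
      fix q assume "q \<in> F ` S"
      then show "q \<in> {q \<in> V. \<phi> q = 0}"
        by (auto simp: S_def F\<Phi> \<phi>_def g\<Phi>)
    next
      fix q assume q: "q \<in> {q \<in> V. \<phi> q = 0}"
      then have "g q = (fst (g q), 0)" by (simp add: \<phi>_def prod_eq_iff)
      with q \<Phi>g[of q] have "q = F (fst (g q))" "fst (g q) \<in> S"
        by (auto simp: F\<Phi> S_def)
      then show "q \<in> F ` S" by blast
    qed
    show "(\<phi> has_derivative blinfun_apply (\<phi>' q)) (at q)" if "q \<in> V" for q
      unfolding \<phi>_def
      by (rule has_derivative_eq_rhs[OF has_derivative_snd[OF g1[OF that]]]) (simp add: \<phi>'_def fun_eq_iff)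
    show "(\<phi>' has_derivative blinfun_apply (\<phi>'' q)) (at q)" if "q \<in> V" for q
    proof -
      have "((\<lambda>q. blinfun_compose_left snd_blinfun (g' q)) has_derivative
          (\<lambda>h. blinfun_compose_left snd_blinfun (g'' q h))) (at q)"
        by (intro bounded_linear.has_derivative[OF blinfun.bounded_linear_right] g2 that)
      then show ?thesis
        unfolding \<phi>'_def blinfun_compose_left.rep_eq
        by (rule has_derivative_eq_rhs) (simp add: \<phi>''_def fun_eq_iff)
    qed
    show "continuous_on V \<phi>''"
      unfolding \<phi>''_def
      by (intro bounded_bilinear.continuous_on[OF bounded_bilinear_blinfun_compose] continuous_on_const cg)
    show "\<phi>' q \<noteq> 0" if "q \<in> V" for q
    proof
      \<comment> \<open>The t component has derivative 1 along the image of (0, 1) under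
        \<open>\<Phi>' (g q)\<close>.\<close>
      assume "\<phi>' q = 0"
      then have "snd_blinfun (g' q (\<Phi>' (g q) (0, 1))) = 0"
        unfolding \<phi>'_def by (metis blinfun_apply_blinfun_compose blinfun.zero_left)
      then show False
        using left[OF that] by (metis blinfun_apply_blinfun_compose blinfun_apply_id_blinfun
            blinfun_apply_snd_blinfun id_apply snd_conv zero_neq_one)
    qed
    have q0: "F x0 \<in> V" "g (F x0) = (x0, 0)" using U' by (auto simp: F\<Phi> g\<Phi>)
    \<comment> \<open>When a vector is split into a tangent part and a multiple of
      \<open>\<nu>\<close>, the differential of \<open>\<phi>\<close> reads off the
      multiple.\<close>
    have key: "\<phi>' (F x0) (F' x0 \<xi> + t *\<^sub>R \<nu>) = t" for \<xi> t
    proof -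
      have "g' (F x0) (\<Phi>' (x0, 0) (\<xi>, t)) = (\<xi>, t)"
        using left[OF q0(1)] q0(2) by (metis blinfun_apply_blinfun_compose blinfun_apply_id_blinfun id_apply)
      moreover have "\<Phi>' (x0, 0) (\<xi>, t) = F' x0 \<xi> + t *\<^sub>R \<nu>"
        by (simp add: \<Phi>'_def blinfun.bilinear_simps)
      ultimately show ?thesis by (simp add: \<phi>'_def)
    qed
    show "{v. \<phi>' (F x0) v = 0} = ?T"
    proof (intro equalityI subsetI)
      fix v assume "v \<in> ?T"
      then show "v \<in> {v. \<phi>' (F x0) v = 0}" using key[of _ 0] by auto
    next
      fix v assume v: "v \<in> {v. \<phi>' (F x0) v = 0}"
      let ?w = "g' (F x0) v"
      have "v = \<Phi>' (x0, 0) ?w"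
        using right[OF q0(1)] q0(2) by (metis blinfun_apply_blinfun_compose blinfun_apply_id_blinfun id_apply)
      then have eq: "v = F' x0 (fst ?w) + snd ?w *\<^sub>R \<nu>"
        by (simp add: \<Phi>'_def blinfun.bilinear_simps)
      then have "snd ?w = 0" using v key[of "fst ?w" "snd ?w"] by simp
      with eq have "v = F' x0 (fst ?w)" by simp
      then show "v \<in> ?T" by blast
    qed
  qed
qed

text \<open>Carries the local equation through a chart. The parametrisation \<open>G\<close> is
  returned along with \<open>\<phi>\<close> since the second derivative test runs along
  \<open>G\<close>, while minimality concerns \<open>\<phi>\<close>.\<close>

lemma C2_immersion_local_defining_function:
  fixes F :: "'m \<Rightarrow> 'n::finite heisenberg" and A :: "('m set \<times> ('m \<Rightarrow> real ^ ('n + 'n))) set"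
  assumes atlas: "C2_atlas M A" and imm: "C2_immersion A F" and p_in: "p \<in> topspace M"
  obtains \<phi> \<phi>' \<phi>'' V S x0 D D'' and G :: "real ^ ('n + 'n) \<Rightarrow> 'n heisenberg" where
    "local_defining_function M F p \<phi>"
    "open V"
    "\<And>q. q \<in> V \<Longrightarrow> (\<phi> has_derivative blinfun_apply (\<phi>' q)) (at q)"
    "\<And>q. q \<in> V \<Longrightarrow> (\<phi>' has_derivative blinfun_apply (\<phi>'' q)) (at q)"
    "\<phi>' (F p) \<noteq> 0"
    "open S" "x0 \<in> S" "G x0 = F p" "G ` S \<subseteq> F ` topspace M"
    "\<And>x. x \<in> S \<Longrightarrow> G x \<in> V \<and> \<phi> (G x) = 0"
    "\<And>x. x \<in> S \<Longrightarrow> (G has_derivative blinfun_apply (D x)) (at x)"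
    "(D has_derivative blinfun_apply D'') (at x0)"
    "inj (blinfun_apply (D x0))"
    "{v. \<phi>' (F p) v = 0} = range (blinfun_apply (D x0))"
proof -
  have "p \<in> (\<Union>(U, c)\<in>A. U)"
    using atlas p_in unfolding C2_atlas_def by simp
  then obtain U c where chart: "(U, c) \<in> A" and p: "p \<in> U"
    by blast
  let ?F = "F \<circ> inv_into U c"
  have "\<forall>(U, c)\<in>A. openin M U \<and> open (c ` U) \<and> homeomorphic_map (subtopology M U) (top_of_set (c ` U)) c"
    using atlas unfolding C2_atlas_def by (elim conjE)
  from bspec[OF this chart]
  have U: "openin M U" "open (c ` U)" and hom: "homeomorphic_map (subtopology M U) (top_of_set (c ` U)) c"
    by simp_all
  have U_sub: "U \<subseteq> topspace M" using U(1) by (rule openin_subset)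
  then have inj_c: "inj_on c U"
    using hom by (simp add: homeomorphic_eq_everything_map topspace_subtopology Int_absorb1)
  have inv_c: "inv_into U c (c m) = m" if "m \<in> U" for m
    using inj_c that by simp
  have C2: "C2_on ?F (c ` U)" and inj_fd: "\<forall>x\<in>c ` U. inj (frechet_derivative ?F (at x))"
    using bspec[OF imm[unfolded C2_immersion_def] chart] by simp_all
  from C2 obtain D DD where D: "\<And>x. x \<in> c ` U \<Longrightarrow> (?F has_derivative blinfun_apply (D x)) (at x)"
    and DD: "\<And>x. x \<in> c ` U \<Longrightarrow> (D has_derivative blinfun_apply (DD x)) (at x)"
    and cont: "continuous_on (c ` U) DD"
    unfolding C2_on_def by blast
  have x0: "c p \<in> c ` U" using p by blast
  have inj: "inj (blinfun_apply (D (c p)))"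
    using bspec[OF inj_fd x0] unfolding frechet_derivative_at[OF D[OF x0], symmetric] .
  show thesis
  proof (rule immersed_hypersurface_local_equation[OF U(2) x0 D DD cont inj])
    fix S V and \<phi> :: "'n heisenberg \<Rightarrow> real" and \<phi>' \<phi>''
    assume S: "open S" "c p \<in> S" "S \<subseteq> c ` U" "inj_on ?F S" and V: "open V"
      and zero: "?F ` S = {q \<in> V. \<phi> q = 0}"
      and \<phi>: "\<And>q. q \<in> V \<Longrightarrow> (\<phi> has_derivative blinfun_apply (\<phi>' q)) (at q)"
      and \<phi>': "\<And>q. q \<in> V \<Longrightarrow> (\<phi>' has_derivative blinfun_apply (\<phi>'' q)) (at q)"
      and cont_\<phi>'': "continuous_on V \<phi>''"
      and nz: "\<And>q. q \<in> V \<Longrightarrow> \<phi>' q \<noteq> 0"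
      and ker: "{v. \<phi>' (?F (c p)) v = 0} = range (blinfun_apply (D (c p)))"
    \<comment> \<open>The part of the chart domain lying over \<open>S\<close>: on it
      \<open>F\<close> is injective and its image is the full zero set, as a local defining function
      requires.\<close>
    define N where "N = {m \<in> U. c m \<in> S}"
    have cN: "c ` N = S" using S by (auto simp: N_def)
    have FN: "F ` N = ?F ` S"
      unfolding cN[symmetric] image_image
      by (rule image_cong) (auto simp: N_def inv_c)
    have "continuous_map (subtopology M U) (top_of_set (c ` U)) c"
      using hom by (simp add: homeomorphic_eq_everything_map)
    then have "openin (subtopology M U) {m \<in> topspace (subtopology M U). c m \<in> S}"
      by (rule openin_continuous_map_preimage) (rule open_subset[OF S(3,1)])
    moreover have "{m \<in> topspace (subtopology M U). c m \<in> S} = N"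
      using U_sub by (auto simp: N_def)
    ultimately have open_N: "openin M N"
      using U(1) openin_trans_full by metis
    have inj_N: "inj_on F N"
    proof (rule inj_onI)
      fix a b assume ab: "a \<in> N" "b \<in> N" "F a = F b"
      then have "?F (c a) = ?F (c b)" by (simp add: N_def inv_c)
      then have "c a = c b" using inj_onD[OF S(4)] ab by (simp add: N_def)
      then show "a = b" using inj_onD[OF inj_c] ab by (simp add: N_def)
    qed
    have Fp: "?F (c p) = F p" by (simp add: inv_c p)
    show thesis
    proof (rule that[of \<phi> V \<phi>' \<phi>'' S "c p" ?F D "DD (c p)"])
      show "local_defining_function M F p \<phi>"
        unfolding local_defining_function_def
      proof (intro exI conjI ballI)
        show "openin M N" "inj_on F N" by fact+
        show "p \<in> N" using p S by (simp add: N_def)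
        show "C2_on \<phi> V" unfolding C2_on_def using V \<phi> \<phi>' cont_\<phi>'' by blast
        show "F ` N = {q \<in> V. \<phi> q = 0}" using FN zero by simp
        fix q assume "q \<in> F ` N"
        then have q: "q \<in> V" using FN zero by auto
        show "frechet_derivative \<phi> (at q) \<noteq> (\<lambda>v. 0)"
          using nz[OF q] frechet_derivative_at[OF \<phi>[OF q]]
          by (metis blinfun_eqI blinfun.zero_left)
      qed
      have "F p \<in> V" using zero S(2) Fp by (metis (mono_tags, lifting) imageI mem_Collect_eq)
      then show "\<phi>' (F p) \<noteq> 0" by (rule nz)
      show "?F x \<in> V \<and> \<phi> (?F x) = 0" if "x \<in> S" for x
        using zero that by blast
      show "?F (c p) = F p" by (rule Fp)
      show "?F ` S \<subseteq> F ` topspace M"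
      proof -
        have "F ` N \<subseteq> F ` topspace M"
          using openin_subset[OF open_N] by (rule image_mono)
        then show ?thesis unfolding FN .
      qed
      show "{v. \<phi>' (F p) v = 0} = range (blinfun_apply (D (c p)))"
        using ker unfolding Fp .
      show "open V" "open S" "c p \<in> S" "inj (blinfun_apply (D (c p)))"
        by fact+
      show "(D has_derivative blinfun_apply (DD (c p))) (at (c p))"
        by (rule DD[OF x0])
      show "(?F has_derivative blinfun_apply (D x)) (at x)" if "x \<in> S" for x
        using S(3) that by (intro D) auto
    qed (fact \<phi> \<phi>')+
  qed
qed

subsection \<open>Horizontal mean curvature and touching\<close>

lemma second_derivative_nonneg_at_local_min:
  fixes \<beta> :: "real \<Rightarrow> real"
  assumes "e > 0" and \<beta>: "\<And>t. \<bar>t\<bar> < e \<Longrightarrow> (\<beta> has_real_derivative \<beta>' t) (at t)"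
    and \<beta>': "(\<beta>' has_real_derivative c) (at 0)"
    and min: "\<And>t. \<bar>t\<bar> < e \<Longrightarrow> \<beta> 0 \<le> \<beta> t"
  shows "c \<ge> 0"
proof (rule ccontr)
  assume "\<not> c \<ge> 0"
  then have "c < 0" by simp
  have zero: "\<beta>' 0 = 0"
    using DERIV_local_min[of \<beta> "\<beta>' 0" 0 e] \<beta>[of 0] \<open>e > 0\<close> min by auto
  obtain d where d: "d > 0" "\<And>h. h > 0 \<Longrightarrow> h < d \<Longrightarrow> \<beta>' h < 0"
    using DERIV_neg_dec_right[OF \<beta>' \<open>c < 0\<close>] zero by auto
  define t where "t = min d e / 2"
  have t: "0 < t" "t < d" "t < e" using d \<open>e > 0\<close> by (auto simp: t_def min_def)
  obtain z where z: "0 < z" "z < t" "\<beta> t - \<beta> 0 = (t - 0) * \<beta>' z"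
    using MVT2[OF t(1), of \<beta> \<beta>'] \<beta> t by auto
  then have "\<beta> t < \<beta> 0"
    using mult_pos_neg[OF t(1) d(2)[of z]] t by simp
  with min[of t] t show False by simp
qed

text \<open>The second derivative of \<open>h\<close> along the image of a line has a term with the
  acceleration \<open>D''\<close>. Its factor \<open>h' (F x0)\<close> vanishes, so only
  \<open>h''\<close> on the velocity remains.\<close>

lemma hessian_nonneg_at_critical_min_along:
  fixes F :: "'e::real_normed_vector \<Rightarrow> 'a::real_normed_vector" and h :: "'a \<Rightarrow> real"
  assumes S: "open S" "x0 \<in> S"
    and F: "\<And>x. x \<in> S \<Longrightarrow> (F has_derivative blinfun_apply (D x)) (at x)"
    and D: "(D has_derivative blinfun_apply D'') (at x0)"
    and h: "\<And>x. x \<in> S \<Longrightarrow> (h has_derivative blinfun_apply (h' (F x))) (at (F x))"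
    and h': "(h' has_derivative blinfun_apply h'') (at (F x0))"
    and min: "\<And>x. x \<in> S \<Longrightarrow> h (F x0) \<le> h (F x)"
    and crit: "h' (F x0) = 0"
  shows "0 \<le> h'' (D x0 \<xi>) (D x0 \<xi>)"
proof -
  have line: "((\<lambda>t. x0 + t *\<^sub>R \<xi>) has_derivative (\<lambda>s. s *\<^sub>R \<xi>)) (at t)" for t
    by (auto intro!: derivative_eq_intros)
  have "open ((\<lambda>t. x0 + t *\<^sub>R \<xi>) -` S)"
    by (intro open_vimage S continuous_intros)
  moreover have "0 \<in> (\<lambda>t. x0 + t *\<^sub>R \<xi>) -` S" using S by simp
  ultimately obtain e where e: "e > 0" "ball 0 e \<subseteq> (\<lambda>t. x0 + t *\<^sub>R \<xi>) -` S"
    by (meson openE)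
  then have inS: "x0 + t *\<^sub>R \<xi> \<in> S" if "\<bar>t\<bar> < e" for t
    using that by (auto simp: subset_iff)
  define \<beta> where "\<beta> t = h (F (x0 + t *\<^sub>R \<xi>))" for t
  define \<beta>' where "\<beta>' t = h' (F (x0 + t *\<^sub>R \<xi>)) (D (x0 + t *\<^sub>R \<xi>) \<xi>)" for t
  have dF: "((\<lambda>t. F (x0 + t *\<^sub>R \<xi>)) has_derivative (\<lambda>s. D (x0 + t *\<^sub>R \<xi>) (s *\<^sub>R \<xi>))) (at t)"
    if "\<bar>t\<bar> < e" for t
    by (rule has_derivative_compose[OF line F[OF inS[OF that]]])
  have "(\<beta> has_real_derivative \<beta>' t) (at t)" if "\<bar>t\<bar> < e" for t
  proof -
    have "(\<beta> has_derivative (\<lambda>s. h' (F (x0 + t *\<^sub>R \<xi>)) (D (x0 + t *\<^sub>R \<xi>) (s *\<^sub>R \<xi>)))) (at t)"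
      unfolding \<beta>_def by (rule has_derivative_compose[OF dF[OF that] h[OF inS[OF that]]])
    then show ?thesis
      unfolding has_field_derivative_def
      by (rule has_derivative_eq_rhs) (simp add: \<beta>'_def blinfun.bilinear_simps fun_eq_iff mult.commute)
  qed
  moreover have "(\<beta>' has_real_derivative h'' (D x0 \<xi>) (D x0 \<xi>)) (at 0)"
  proof -
    have "((\<lambda>t. F (x0 + t *\<^sub>R \<xi>)) has_derivative (\<lambda>s. D x0 (s *\<^sub>R \<xi>))) (at 0)"
      using dF[of 0] e by simp
    then have h'F: "((\<lambda>t. h' (F (x0 + t *\<^sub>R \<xi>))) has_derivative (\<lambda>s. h'' (D x0 (s *\<^sub>R \<xi>)))) (at 0)"
      by (rule has_derivative_compose) (use h' in simp)
    have "((\<lambda>t. D (x0 + t *\<^sub>R \<xi>)) has_derivative (\<lambda>s. D'' (s *\<^sub>R \<xi>))) (at 0)"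
      by (rule has_derivative_compose[OF line]) (use D in simp)
    then have D\<xi>: "((\<lambda>t. D (x0 + t *\<^sub>R \<xi>) \<xi>) has_derivative (\<lambda>s. D'' (s *\<^sub>R \<xi>) \<xi>)) (at 0)"
      by (rule bounded_linear.has_derivative[OF blinfun.bounded_linear_left])
    show ?thesis
      unfolding has_field_derivative_def \<beta>'_def
      by (rule has_derivative_eq_rhs[OF blinfun.FDERIV[OF h'F D\<xi>]])
        (simp add: crit blinfun.bilinear_simps fun_eq_iff mult.commute)
  qed
  ultimately show ?thesis
  proof (rule second_derivative_nonneg_at_local_min[OF e(1)])
    show "\<beta> 0 \<le> \<beta> t" if "\<bar>t\<bar> < e" for t
      using min[OF inS[OF that]] by (simp add: \<beta>_def)
  qed
qed

section \<open>Mean curvature as a quadratic form in the second derivative\<close>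

definition hgrad :: "('n::finite heisenberg \<Rightarrow>\<^sub>L real) \<Rightarrow> 'n heisenberg \<Rightarrow> 'n heisenberg" where
  "hgrad d q = (\<Sum>I\<in>UNIV. d (hframe I q) *\<^sub>R hframe I q)"

text \<open>
  For d and B the first and second derivatives of \<open>\<phi>\<close> this is the mean curvature times the cube of
  the norm of the horizontal gradient. Second derivatives along the frame are $B(e_I, e_J)$ up to
  terms antisymmetric in I and J, which cancel.
\<close>

definition hmc_form ::
    "('n::finite heisenberg \<Rightarrow>\<^sub>L real) \<Rightarrow> ('n heisenberg \<Rightarrow>\<^sub>L 'n heisenberg \<Rightarrow>\<^sub>L real) \<Rightarrow> 'n heisenberg \<Rightarrow> real" where
  "hmc_form d B q =
     (\<Sum>K\<in>UNIV. (d (hframe K q))\<^sup>2) * (\<Sum>I\<in>UNIV. B (hframe I q) (hframe I q)) - B (hgrad d q) (hgrad d q)"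

text \<open>Where the horizontal gradient is nonzero, the form is a positive multiple of the trace
  of \<open>B\<close> over the horizontal part of the kernel of \<open>d\<close>, and it inherits
  the sign of \<open>B\<close> there.\<close>

lemma hmc_form_nonneg:
  fixes d :: "'n::finite heisenberg \<Rightarrow>\<^sub>L real" and B :: "'n heisenberg \<Rightarrow>\<^sub>L 'n heisenberg \<Rightarrow>\<^sub>L real"
  assumes "\<And>v. d v = 0 \<Longrightarrow> B v v \<ge> 0"
  shows "hmc_form d B q \<ge> 0"
proof -
  define p where "p K = d (hframe K q)" for K
  define P where "P = (\<Sum>K\<in>UNIV. (p K)\<^sup>2)"
  define w where "w = hgrad d q"
  have P: "P \<ge> 0" unfolding P_def by (intro sum_nonneg) auto
  have w: "w = (\<Sum>I\<in>UNIV. p I *\<^sub>R hframe I q)"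
    by (simp add: w_def hgrad_def p_def)
  have dw: "d w = P"
    by (simp add: w blinfun.bilinear_simps blinfun.sum_right P_def p_def power2_eq_square)
  \<comment> \<open>The form equals $\frac{1}{P} \sum_K B(v_K, v_K)$ for these tangent vectors.\<close>
  define v where "v K = P *\<^sub>R hframe K q - p K *\<^sub>R w" for K
  have "d (v K) = 0" for K
    by (simp add: v_def blinfun.bilinear_simps dw p_def)
  then have "0 \<le> (\<Sum>K\<in>UNIV. B (v K) (v K))"
    by (intro sum_nonneg assms)
  also have "\<dots> = (\<Sum>K\<in>UNIV. P\<^sup>2 * B (hframe K q) (hframe K q) - P * (p K * B (hframe K q) w)
      - P * (p K * B w (hframe K q)) + (p K)\<^sup>2 * B w w)"
    by (intro sum.cong) (simp_all add: v_def blinfun.bilinear_simps power2_eq_square algebra_simps)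
  also have "\<dots> = P\<^sup>2 * (\<Sum>K\<in>UNIV. B (hframe K q) (hframe K q)) - P * (\<Sum>K\<in>UNIV. p K * B (hframe K q) w)
      - P * (\<Sum>K\<in>UNIV. p K * B w (hframe K q)) + P * B w w"
    by (simp add: sum.distrib sum_subtractf sum_distrib_left sum_distrib_right P_def)
  also have "(\<Sum>K\<in>UNIV. p K * B (hframe K q) w) = B w w"
    by (subst (2) w) (simp add: blinfun.bilinear_simps blinfun.sum_left blinfun.sum_right)
  also have "(\<Sum>K\<in>UNIV. p K * B w (hframe K q)) = B w w"
    by (subst (3) w) (simp add: blinfun.bilinear_simps blinfun.sum_left blinfun.sum_right)
  finally have "0 \<le> P * hmc_form d B q"
    by (simp add: hmc_form_def flip: p_def P_def w_def) (simp add: power2_eq_square algebra_simps)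
  show ?thesis
  proof (cases "P = 0")
    case True
    then have "p K = 0" for K
      unfolding P_def by (simp add: sum_nonneg_eq_0_iff)
    then have "w = 0" by (simp add: w)
    then show ?thesis using True by (simp add: hmc_form_def flip: p_def P_def w_def)
  next
    case False
    with P \<open>0 \<le> P * hmc_form d B q\<close> show ?thesis
      by (simp add: zero_le_mult_iff)
  qed
qed

fun hframe_deriv :: "'n::finite + 'n \<Rightarrow> 'n heisenberg \<Rightarrow> 'n heisenberg" where
  "hframe_deriv (Inl j) v = (0, fst v $ Inr j)"
| "hframe_deriv (Inr j) v = (0, - (fst v $ Inl j))"

lemma hframe_has_derivative: "(hframe I has_derivative hframe_deriv I) (at q)"
proof (cases I)
  case (Inl j)
  have "((\<lambda>q. (axis (Inl j) 1, fst q $ Inr j)) has_derivative hframe_deriv (Inl j)) (at q)"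
    by (auto intro!: derivative_eq_intros bounded_linear.has_derivative[OF bounded_linear_vec_nth])
  moreover have "hframe (Inl j) = (\<lambda>q. (axis (Inl j) 1, fst q $ Inr j))"
    by auto
  ultimately show ?thesis by (simp add: Inl)
next
  case (Inr j)
  have "((\<lambda>q. (axis (Inr j) 1, - (fst q $ Inl j))) has_derivative hframe_deriv (Inr j)) (at q)"
    by (auto intro!: derivative_eq_intros bounded_linear.has_derivative[OF bounded_linear_vec_nth])
  moreover have "hframe (Inr j) = (\<lambda>q. (axis (Inr j) 1, - (fst q $ Inl j)))"
    by auto
  ultimately show ?thesis by (simp add: Inr)
qed

lemma fst_hframe: "fst (hframe I q) = axis I 1"
  by (cases I) auto

lemma fst_hgrad:
  fixes d :: "'n::finite heisenberg \<Rightarrow>\<^sub>L real"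
  shows "fst (hgrad d q) $ I = d (hframe I q)"
  by (simp add: hgrad_def fst_sum fst_hframe sum_component axis_def if_distrib cong: if_cong)

lemma sum_UNIV_Plus:
  "(\<Sum>I\<in>UNIV. f I) = (\<Sum>j\<in>UNIV. f (Inl j)) + (\<Sum>j\<in>UNIV. f (Inr j))"
  for f :: "'a::finite + 'b::finite \<Rightarrow> 'c::comm_monoid_add"
  by (simp add: sum.Plus flip: UNIV_Plus_UNIV)

text \<open>Each summand vanishes: the z coefficient of a frame vector depends on the conjugate
  coordinate only, which that vector does not move.\<close>

lemma sum_hframe_deriv_self: "(\<Sum>I\<in>UNIV. hframe_deriv I (hframe I q)) = 0"
  by (simp add: sum_UNIV_Plus axis_def flip: zero_prod_def)

text \<open>Differentiating the frame along the gradient produces the gradient rotated by the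
  symplectic structure, and a vector is orthogonal to its own rotation.\<close>

lemma sum_hframe_deriv_hgrad:
  fixes d :: "'n::finite heisenberg \<Rightarrow>\<^sub>L real"
  shows "(\<Sum>I\<in>UNIV. d (hframe I q) *\<^sub>R hframe_deriv I (hgrad d q)) = 0"
proof -
  have "(\<Sum>I\<in>UNIV. d (hframe I q) *\<^sub>R hframe_deriv I (hgrad d q))
    = (0, (\<Sum>j\<in>UNIV. d (hframe (Inl j) q) * d (hframe (Inr j) q)) - (\<Sum>j\<in>UNIV. d (hframe (Inr j) q) * d (hframe (Inl j) q)))"
    by (simp add: sum_UNIV_Plus fst_hgrad prod_eq_iff fst_sum snd_sum sum_negf del: hframe.simps)
  then show ?thesis by (simp add: mult.commute zero_prod_def)
qed

lemma hderiv_eq: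
  assumes "(\<phi> has_derivative d) (at q)"
  shows "hderiv I \<phi> q = d (hframe I q)"
  using frechet_derivative_at[OF assms] by (simp add: hderiv_def)

lemma hmean_curvature_eq_hmc_form:
  fixes \<phi> :: "'n::finite heisenberg \<Rightarrow> real"
  assumes V: "open V" "q \<in> V"
    and \<phi>: "\<And>r. r \<in> V \<Longrightarrow> (\<phi> has_derivative blinfun_apply (\<phi>' r)) (at r)"
    and \<phi>': "(\<phi>' has_derivative blinfun_apply B) (at q)"
    and nz: "hgrad_norm \<phi> q \<noteq> 0"
  shows "hmean_curvature \<phi> q = hmc_form (\<phi>' q) B q / (hgrad_norm \<phi> q) ^ 3"
proof -
  define f where "f I r = \<phi>' r (hframe I r)" for I r
  define N where "N r = sqrt (\<Sum>K\<in>UNIV. (f K r)\<^sup>2)" for r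
  define d where "d = \<phi>' q"
  define p where "p I = d (hframe I q)" for I
  \<comment> \<open>The derivative of \<open>f I\<close> by the product rule: the frame field varies
    as well as the differential of \<open>\<phi>\<close>.\<close>
  define m where "m I v = d (hframe_deriv I v) + B v (hframe I q)" for I v
  have hd: "hderiv I \<phi> r = f I r" if "r \<in> V" for I r
    unfolding f_def by (rule hderiv_eq[OF \<phi>[OF that]])
  have hN: "hgrad_norm \<phi> r = N r" if "r \<in> V" for r
    by (simp add: hgrad_norm_def N_def hd that)
  have fq: "f I q = p I" for I by (simp add: f_def p_def d_def)
  have Nq: "N q > 0" "(\<Sum>K\<in>UNIV. (p K)\<^sup>2) = (N q)\<^sup>2"
  proof -
    have "0 \<le> (\<Sum>K\<in>UNIV. (p K)\<^sup>2)" by (intro sum_nonneg) auto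
    then show "N q > 0" "(\<Sum>K\<in>UNIV. (p K)\<^sup>2) = (N q)\<^sup>2"
      using nz hN[OF V(2)] by (auto simp: N_def fq)
  qed
  have df: "(f I has_derivative m I) (at q)" for I
    unfolding f_def m_def d_def
    by (rule blinfun.FDERIV[OF \<phi>' hframe_has_derivative])
  have dN: "(N has_derivative (\<lambda>v. (\<Sum>K\<in>UNIV. p K * m K v) / N q)) (at q)"
  proof -
    have sq: "((\<lambda>r. \<Sum>K\<in>UNIV. (f K r)\<^sup>2) has_derivative (\<lambda>v. \<Sum>K\<in>UNIV. 2 * (p K * m K v))) (at q)"
      by (rule has_derivative_sum) (auto intro!: derivative_eq_intros df simp: fq)
    have pos: "0 < (\<Sum>K\<in>UNIV. (f K q)\<^sup>2)" using Nq by (simp add: fq)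
    have "(N has_derivative (\<lambda>v. (\<Sum>K\<in>UNIV. 2 * (p K * m K v)) / (2 * N q))) (at q)"
      unfolding N_def by (rule has_derivative_eq_rhs[OF has_derivative_real_sqrt[OF pos sq]]) (simp add: fun_eq_iff field_simps)
    then show ?thesis
      by (simp flip: sum_distrib_left)
  qed
  have quot: "hderiv I (\<lambda>r. hderiv I \<phi> r / hgrad_norm \<phi> r) q
      = m I (hframe I q) / N q - (\<Sum>K\<in>UNIV. p I * (p K * m K (hframe I q))) / (N q) ^ 3" for I
  proof -
    have "((\<lambda>r. f I r / N r) has_derivative
        (\<lambda>v. m I v / N q - p I * ((\<Sum>K\<in>UNIV. p K * m K v) / N q) / (N q)\<^sup>2)) (at q)"
      using Nq by (auto intro!: derivative_eq_intros df dN simp: fq fun_eq_iff field_simps power2_eq_square)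
    \<comment> \<open>The curvature differentiates \<open>hderiv\<close> and
      \<open>hgrad_norm\<close>, which are known to agree with \<open>f\<close> and \<open>N\<close>
      on the open set \<open>V\<close>.\<close>
    then have "((\<lambda>r. hderiv I \<phi> r / hgrad_norm \<phi> r) has_derivative
        (\<lambda>v. m I v / N q - p I * ((\<Sum>K\<in>UNIV. p K * m K v) / N q) / (N q)\<^sup>2)) (at q)"
      by (rule has_derivative_transform_within_open[OF _ V]) (simp add: hd hN)
    from hderiv_eq[OF this] show ?thesis
      by (simp add: sum_distrib_left power3_eq_cube power2_eq_square)
  qed
  have trace: "(\<Sum>I\<in>UNIV. m I (hframe I q)) = (\<Sum>I\<in>UNIV. B (hframe I q) (hframe I q))"
  proof -
    have "(\<Sum>I\<in>UNIV. d (hframe_deriv I (hframe I q))) = 0"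
      by (simp add: sum_hframe_deriv_self flip: blinfun.sum_right)
    then show ?thesis by (simp add: m_def sum.distrib)
  qed
  have linm: "linear (m K)" for K
    using has_derivative_linear[OF df] .
  \<comment> \<open>Summing over I first assembles the gradient, so the double sum becomes a
    derivative along \<open>hgrad d q\<close>.\<close>
  have "(\<Sum>I\<in>UNIV. \<Sum>K\<in>UNIV. p I * (p K * m K (hframe I q))) = (\<Sum>K\<in>UNIV. p K * m K (hgrad d q))"
    by (subst sum.swap)
      (simp add: hgrad_def linear_sum[OF linm] linear_cmul[OF linm] sum_distrib_left p_def mult.left_commute)
  also have "\<dots> = d (\<Sum>K\<in>UNIV. p K *\<^sub>R hframe_deriv K (hgrad d q)) + B (hgrad d q) (\<Sum>K\<in>UNIV. p K *\<^sub>R hframe K q)"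
    by (simp add: m_def distrib_left sum.distrib blinfun.sum_right blinfun.bilinear_simps)
  also have "\<dots> = B (hgrad d q) (hgrad d q)"
    unfolding p_def sum_hframe_deriv_hgrad by (simp add: hgrad_def blinfun.bilinear_simps)
  finally have "hmean_curvature \<phi> q
      = (\<Sum>I\<in>UNIV. B (hframe I q) (hframe I q)) / N q - B (hgrad d q) (hgrad d q) / (N q) ^ 3"
    by (simp add: hmean_curvature_def quot sum_subtractf trace flip: sum_divide_distrib)
  also have "\<dots> = hmc_form d B q / (N q) ^ 3"
    using Nq by (simp add: hmc_form_def flip: p_def) (simp add: field_simps power3_eq_cube power2_eq_square)
  finally show ?thesis by (simp add: hN V d_def)
qed

section \<open>Comparison at a point of touching\<close>

lemma contact_form_hframe: "contact_form q (hframe I q) = 0"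
  by (cases I) (simp_all add: contact_form_def axis_def if_distrib[where f="(*) c" for c] sum_negf cong: if_cong)

text \<open>A Lagrange multiplier argument. At the minimum f' = c \<phi>', so f - c \<phi> is
  critical there; it equals f on the surface, hence its second derivative is nonnegative on the
  tangent space. The form is linear in its second argument, where the share of \<phi> vanishes by
  minimality, and quadratic in its first, so that c enters as a square.\<close>

lemma hmc_form_at_touching_point_nonneg:
  fixes F :: "'m \<Rightarrow> 'n::finite heisenberg" and A :: "('m set \<times> ('m \<Rightarrow> real ^ ('n + 'n))) set"
  assumes atlas: "C2_atlas M A" and imm: "C2_immersion A F"
    and minimal: "horizontally_minimal M F"
    and p: "p \<in> topspace M"
    and N: "open N" "F p \<in> N"
    and f: "\<And>q. q \<in> N \<Longrightarrow> (f has_derivative blinfun_apply (f' q)) (at q)"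
    and f': "(f' has_derivative blinfun_apply f'') (at (F p))"
    and min: "\<And>m. m \<in> topspace M \<Longrightarrow> f (F p) \<le> f (F m)"
    and noncharacteristic: "f' (F p) (hframe I (F p)) \<noteq> 0"
  shows "hmc_form (f' (F p)) f'' (F p) \<ge> 0"
proof (rule C2_immersion_local_defining_function[OF atlas imm p])
  fix \<phi> \<phi>' \<phi>'' V S x0 D D'' and G :: "real ^ ('n + 'n) \<Rightarrow> 'n heisenberg"
  assume loc: "local_defining_function M F p \<phi>"
    and V: "open V"
    and \<phi>: "\<And>q. q \<in> V \<Longrightarrow> (\<phi> has_derivative blinfun_apply (\<phi>' q)) (at q)"
    and \<phi>': "\<And>q. q \<in> V \<Longrightarrow> (\<phi>' has_derivative blinfun_apply (\<phi>'' q)) (at q)"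
    and nz: "\<phi>' (F p) \<noteq> 0"
    and S: "open S" "x0 \<in> S" and Gx0: "G x0 = F p" and GM: "G ` S \<subseteq> F ` topspace M"
    and zero: "\<And>x. x \<in> S \<Longrightarrow> G x \<in> V \<and> \<phi> (G x) = 0"
    and G: "\<And>x. x \<in> S \<Longrightarrow> (G has_derivative blinfun_apply (D x)) (at x)"
    and D: "(D has_derivative blinfun_apply D'') (at x0)"
    and ker: "{v. \<phi>' (F p) v = 0} = range (blinfun_apply (D x0))"
  let ?q = "F p"
  have q: "?q \<in> V" using zero[OF S(2)] Gx0 by simp
  define T where "T = S \<inter> G -` N"
  have contG: "continuous_on S G"
    by (intro continuous_at_imp_continuous_on ballI has_derivative_continuous[OF G])
  have T: "open T" "x0 \<in> T" "T \<subseteq> S"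
    unfolding T_def using continuous_open_preimage[OF contG S(1) N(1)] S(2) N(2) Gx0 by simp_all
  have minG: "f (G x0) \<le> f (G x)" if "x \<in> T" for x
  proof -
    have "G x \<in> F ` topspace M" using subsetD[OF GM imageI[OF subsetD[OF T(3) that]]] .
    then obtain m where "m \<in> topspace M" "G x = F m" by (elim imageE)
    then show ?thesis using min Gx0 by simp
  qed
  have f'D: "f' ?q (D x0 \<xi>) = 0" for \<xi>
  proof -
    have "((\<lambda>x. f (G x)) has_derivative (\<lambda>\<xi>. f' (G x0) (D x0 \<xi>))) (at x0)"
      by (rule has_derivative_compose[OF G[OF S(2)] f]) (use N Gx0 in simp)
    then have "(\<lambda>\<xi>. f' (G x0) (D x0 \<xi>)) = (\<lambda>\<xi>. 0)"
      by (rule differential_zero_maxmin[OF T(2,1)]) (simp add: minG)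
    from fun_cong[OF this] show ?thesis unfolding Gx0 .
  qed
  obtain w where w: "\<phi>' ?q w \<noteq> 0"
    using nz by (metis blinfun_eqI blinfun.zero_left)
  define c where "c = f' ?q w / \<phi>' ?q w"
  have f'_eq: "f' ?q = c *\<^sub>R \<phi>' ?q"
  \<comment> \<open>The kernel of \<open>\<phi>' ?q\<close> together with \<open>w\<close> spans the
    space, and \<open>f' ?q\<close> vanishes on that kernel by \<open>f'D\<close>.\<close>
  proof (rule blinfun_eqI)
    fix v
    have "v - (\<phi>' ?q v / \<phi>' ?q w) *\<^sub>R w \<in> {v. \<phi>' ?q v = 0}"
      using w by (simp add: blinfun.bilinear_simps)
    then have "f' ?q (v - (\<phi>' ?q v / \<phi>' ?q w) *\<^sub>R w) = 0"
      unfolding ker using f'D by auto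
    then show "f' ?q v = (c *\<^sub>R \<phi>' ?q) v"
      using w by (simp add: blinfun.bilinear_simps c_def field_simps)
  qed
  define B where "B = f'' - c *\<^sub>R \<phi>'' ?q"
  have "B v v \<ge> 0" if "\<phi>' ?q v = 0" for v
  proof -
    have "v \<in> range (blinfun_apply (D x0))" using that ker by blast
    then obtain \<xi> where \<xi>: "v = D x0 \<xi>" by blast
    have 1: "((\<lambda>r. f r - c * \<phi> r) has_derivative blinfun_apply (f' (G x) - c *\<^sub>R \<phi>' (G x))) (at (G x))"
      if "x \<in> T" for x
    proof -
      have "G x \<in> N" "G x \<in> V" using that zero[of x] by (auto simp: T_def)
      then have "((\<lambda>r. f r - c * \<phi> r) has_derivative (\<lambda>v. f' (G x) v - c * \<phi>' (G x) v)) (at (G x))"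
        by (intro has_derivative_diff has_derivative_mult_right f \<phi>)
      then show ?thesis
        by (rule has_derivative_eq_rhs) (simp add: blinfun.bilinear_simps fun_eq_iff)
    qed
    have 2: "((\<lambda>r. f' r - c *\<^sub>R \<phi>' r) has_derivative blinfun_apply B) (at (G x0))"
      unfolding Gx0
      by (rule has_derivative_eq_rhs[OF has_derivative_diff[OF f' has_derivative_scaleR_right[OF \<phi>'[OF q]]]])
        (simp add: B_def blinfun.bilinear_simps fun_eq_iff)
    show ?thesis
      unfolding \<xi>
    proof (rule hessian_nonneg_at_critical_min_along[OF T(1,2) G D 1 2])
      show "f (G x0) - c * \<phi> (G x0) \<le> f (G x) - c * \<phi> (G x)" if "x \<in> T" for x
        using minG[OF that] zero[of x] zero[of x0] that T by (simp add: subset_iff)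
      show "f' (G x0) - c *\<^sub>R \<phi>' (G x0) = 0"
        by (simp add: Gx0 f'_eq)
    qed (use T in auto)
  qed
  then have B_nonneg: "hmc_form (\<phi>' ?q) B ?q \<ge> 0"
    by (rule hmc_form_nonneg)
  \<comment> \<open>The frame vector \<open>I\<close> lies in the contact plane but not in the
    tangent space, so the point is nonsingular and minimality applies.\<close>
  have hI: "hderiv I \<phi> ?q \<noteq> 0"
    using noncharacteristic by (auto simp: hderiv_eq[OF \<phi>[OF q]] f'_eq blinfun.bilinear_simps)
  have "\<not> singular_at \<phi> ?q"
  proof
    assume "singular_at \<phi> ?q"
    moreover have "hframe I ?q \<in> contact_plane ?q"
      by (simp add: contact_plane_def contact_form_hframe)
    ultimately have "frechet_derivative \<phi> (at ?q) (hframe I ?q) = 0"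
      by (simp add: singular_at_def)
    then show False using hI by (simp add: hderiv_def)
  qed
  then have H0: "hmean_curvature \<phi> ?q = 0"
    using minimal loc p by (simp add: horizontally_minimal_def)
  have norm_nz: "hgrad_norm \<phi> ?q \<noteq> 0"
    using hI by (auto simp: hgrad_norm_def sum_nonneg_eq_0_iff)
  have "hmc_form (\<phi>' ?q) (\<phi>'' ?q) ?q = 0"
    using H0 norm_nz hmean_curvature_eq_hmc_form[OF V q \<phi> \<phi>'[OF q] norm_nz] by simp
  moreover have "hmc_form (\<phi>' ?q) f'' ?q = hmc_form (\<phi>' ?q) B ?q + c * hmc_form (\<phi>' ?q) (\<phi>'' ?q) ?q"
    by (simp add: hmc_form_def B_def blinfun.bilinear_simps sum_subtractf sum_distrib_left algebra_simps)
  ultimately have "hmc_form (\<phi>' ?q) f'' ?q \<ge> 0" using B_nonneg by simp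
  moreover have "hmc_form (f' ?q) f'' ?q = c\<^sup>2 * hmc_form (\<phi>' ?q) f'' ?q"
  proof -
    have "hgrad (f' ?q) ?q = c *\<^sub>R hgrad (\<phi>' ?q) ?q"
      by (simp add: hgrad_def f'_eq blinfun.bilinear_simps scaleR_sum_right)
    moreover have "(\<Sum>K\<in>UNIV. (f' ?q (hframe K ?q))\<^sup>2) = c\<^sup>2 * (\<Sum>K\<in>UNIV. (\<phi>' ?q (hframe K ?q))\<^sup>2)"
      by (simp add: f'_eq blinfun.bilinear_simps power_mult_distrib sum_distrib_left)
    ultimately show ?thesis
      by (simp add: hmc_form_def blinfun.bilinear_simps power2_eq_square algebra_simps)
  qed
  ultimately show ?thesis by simp
qed

text \<open>\<open>l\<close> plus any small multiple of a component of \<open>P\<close> is minimal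
  along \<open>G\<close>, so \<open>l\<close> and \<open>P\<close> both annihilate the range of
  \<open>D x0\<close>. By \<open>kernel\<close> this range lies in the z axis, whereas injectivity
  gives it dimension at least 2.\<close>

lemma no_immersed_min_at_kink:
  fixes G :: "'e::euclidean_space \<Rightarrow> 'b::real_normed_vector \<times> real"
    and l :: "('b \<times> real) \<Rightarrow>\<^sub>L real" and P :: "('b \<times> real) \<Rightarrow>\<^sub>L 'c::real_inner"
  assumes dim: "DIM('e) \<ge> 2"
    and S: "open S" "x0 \<in> S"
    and G: "\<And>x. x \<in> S \<Longrightarrow> (G has_derivative blinfun_apply (D x)) (at x)"
    and inj: "inj (blinfun_apply (D x0))"
    and zero: "P (G x0) = 0"
    and min: "\<And>x. x \<in> S \<Longrightarrow> l (G x0) + 1 \<le> l (G x) + 1 / (1 + norm (P (G x)))"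
    and kernel: "\<And>v. l v = 0 \<Longrightarrow> P v = 0 \<Longrightarrow> fst v = 0"
  shows False
proof -
  have contG: "continuous_on S G"
    by (meson G has_derivative_continuous continuous_at_imp_continuous_on)
  \<comment> \<open>For s between 0 and 1 the convex function 1 / (1 + s) lies below its chord 1 - s
    / 2. This fixes the bound 1 here and the bound 1/2 on \<open>norm a\<close> below.\<close>
  define T where "T = S \<inter> (\<lambda>x. norm (P (G x))) -` {..<1}"
  have T: "open T" "x0 \<in> T" "T \<subseteq> S"
    using S zero by (auto simp: T_def intro!: continuous_open_preimage continuous_intros contG)
  \<comment> \<open>The concave kink dominates small linear perturbations of l, so these have a minimum as well.\<close>
  have key: "l (D x0 \<xi>) + a \<bullet> P (D x0 \<xi>) = 0" if a: "norm a \<le> 1/2" for a \<xi>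
  proof -
    have "((\<lambda>x. l (G x) + a \<bullet> P (G x)) has_derivative (\<lambda>\<xi>. l (D x0 \<xi>) + a \<bullet> P (D x0 \<xi>))) (at x0)"
      by (intro has_derivative_add has_derivative_inner_right
          bounded_linear.has_derivative[OF blinfun.bounded_linear_right] G S)
    moreover have "l (G x0) + a \<bullet> P (G x0) \<le> l (G x) + a \<bullet> P (G x)" if "x \<in> T" for x
    proof -
      define s where "s = norm (P (G x))"
      have s: "0 \<le> s" "s < 1" using that by (auto simp: s_def T_def)
      have "- (a \<bullet> P (G x)) \<le> norm a * s"
        using Cauchy_Schwarz_ineq2[of a "P (G x)"] by (simp add: s_def)
      also have "\<dots> \<le> 1/2 * s"
        using a s by (intro mult_right_mono) auto
      finally have "- (a \<bullet> P (G x)) \<le> s / 2" by simp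
      moreover have "1 / (1 + s) \<le> 1 - s / 2"
        using s mult_nonneg_nonneg[of s "1 - s"] by (simp add: field_simps)
      moreover have "l (G x0) + 1 \<le> l (G x) + 1 / (1 + s)"
        using min[of x] that T unfolding s_def by blast
      ultimately show ?thesis using zero by simp
    qed
    ultimately show ?thesis
      using differential_zero_maxmin[OF T(2,1)] by meson
  qed
  have fst0: "fst (D x0 \<xi>) = 0" for \<xi>
  proof (rule kernel)
    show l0: "l (D x0 \<xi>) = 0" using key[of 0 \<xi>] by simp
    let ?v = "P (D x0 \<xi>)"
    \<comment> \<open>\<open>?v\<close> is shortened enough for \<open>key\<close>; testing with
      this multiple gives a positive multiple of the squared norm of \<open>?v\<close>.\<close>
    have "norm ((1 / (2 * (1 + norm ?v))) *\<^sub>R ?v) \<le> 1/2"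
      using add_pos_nonneg[OF zero_less_one norm_ge_zero, of ?v] by (simp add: divide_le_eq)
    from key[OF this, of \<xi>] l0 have "(1 / (2 * (1 + norm ?v))) * (?v \<bullet> ?v) = 0" by simp
    moreover have "1 + norm ?v \<noteq> 0" using norm_ge_zero[of ?v] by linarith
    ultimately show "?v = 0" by simp
  qed
  have lin: "linear (\<lambda>\<xi>. snd (D x0 \<xi>))"
    by (intro bounded_linear.linear bounded_linear_snd_comp blinfun.bounded_linear_right)
  have "inj (\<lambda>\<xi>. snd (D x0 \<xi>))"
    using inj fst0 by (simp add: inj_def prod_eq_iff)
  then have "dim (range (\<lambda>\<xi>. snd (D x0 \<xi>))) = DIM('e)"
    using dim_image_eq[OF lin, of UNIV] by simp
  moreover have "dim (range (\<lambda>\<xi>. snd (D x0 \<xi>))) \<le> 1"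
    using dim_subset_UNIV[of "range (\<lambda>\<xi>. snd (D x0 \<xi>))"] by simp
  ultimately show False using dim by simp
qed

subsection \<open>The barrier\<close>

definition barrier :: "('a::real_normed_vector \<Rightarrow>\<^sub>L real) \<Rightarrow> ('a \<Rightarrow>\<^sub>L 'c::real_inner) \<Rightarrow> 'a \<Rightarrow> real" where
  "barrier l P q = l q + 1 / (1 + norm (P q))"

text \<open>This is -psi'(r) / r for psi(r) = 1 / (1 + r). With the factor 1 / r included, the
  gradient of psi(r) is minus this slope times the position vector, without normalisation.\<close>

definition barrier_slope :: "real \<Rightarrow> real" where
  "barrier_slope r = 1 / (r * (1 + r)\<^sup>2)"

definition barrier_deriv :: "('a::real_normed_vector \<Rightarrow>\<^sub>L real) \<Rightarrow> ('a \<Rightarrow>\<^sub>L 'c::real_inner) \<Rightarrow> 'a \<Rightarrow> 'a \<Rightarrow>\<^sub>L real" where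
  "barrier_deriv l P q = l - barrier_slope (norm (P q)) *\<^sub>R (blinfun_inner_right (P q) o\<^sub>L P)"

lemma has_derivative_norm_blinfun:
  fixes P :: "'a::real_normed_vector \<Rightarrow>\<^sub>L 'c::real_inner"
  assumes "P q \<noteq> 0"
  shows "((\<lambda>q. norm (P q)) has_derivative (\<lambda>v. (P q \<bullet> P v) / norm (P q))) (at q)"
proof -
  have "((\<lambda>q. norm (P q)) has_derivative (\<lambda>v. P v \<bullet> sgn (P q))) (at q)"
    by (rule has_derivative_compose[where f="blinfun_apply P" and g=norm, OF _ has_derivative_norm[OF assms]])
      (rule bounded_linear.has_derivative[OF blinfun.bounded_linear_right has_derivative_ident])
  then show ?thesis
    by (rule has_derivative_eq_rhs) (simp add: sgn_div_norm fun_eq_iff inner_commute field_simps)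
qed

lemma barrier_has_derivative:
  fixes l :: "'a::real_normed_vector \<Rightarrow>\<^sub>L real" and P :: "'a \<Rightarrow>\<^sub>L 'c::real_inner"
  assumes "P q \<noteq> 0"
  shows "(barrier l P has_derivative blinfun_apply (barrier_deriv l P q)) (at q)"
proof -
  have "1 + norm (P q) > 0" by (simp add: add_pos_nonneg)
  then have "((\<lambda>s. 1 / (1 + s)) has_real_derivative - (1 / (1 + norm (P q))\<^sup>2)) (at (norm (P q)))"
    by (auto intro!: derivative_eq_intros simp: field_simps power2_eq_square)
  from has_derivative_compose[OF has_derivative_norm_blinfun[OF assms] this[unfolded has_field_derivative_def]]
  have "((\<lambda>q. 1 / (1 + norm (P q))) has_derivative (\<lambda>v. - (1 / (1 + norm (P q))\<^sup>2) * ((P q \<bullet> P v) / norm (P q)))) (at q)" .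
  then have "((\<lambda>q. l q + 1 / (1 + norm (P q))) has_derivative
      (\<lambda>v. l v + - (1 / (1 + norm (P q))\<^sup>2) * ((P q \<bullet> P v) / norm (P q)))) (at q)"
    by (intro has_derivative_add bounded_linear.has_derivative[OF blinfun.bounded_linear_right] has_derivative_ident)
  then show ?thesis
    unfolding barrier_def
    by (rule has_derivative_eq_rhs) (simp add: barrier_deriv_def barrier_slope_def blinfun.bilinear_simps fun_eq_iff mult.commute)
qed

text \<open>Values on the diagonal suffice, as \<open>hmc_form\<close> evaluates the second
  derivative only there.\<close>

lemma barrier_deriv_has_derivative:
  fixes l :: "'a::real_normed_vector \<Rightarrow>\<^sub>L real" and P :: "'a \<Rightarrow>\<^sub>L 'c::real_inner"
  assumes "P q \<noteq> 0" and r: "r = norm (P q)"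
  obtains B where "(barrier_deriv l P has_derivative blinfun_apply B) (at q)"
    "\<And>v. B v v = - barrier_slope r * (P v \<bullet> P v)
      + (barrier_slope r / r + 2 / (r * (1 + r) ^ 3)) / r * (P q \<bullet> P v)\<^sup>2"
proof -
  \<comment> \<open>The derivative of the slope at r: the first piece comes from the factor 1 / r,
    the second is -psi''(r) / r.\<close>
  define \<kappa>' where "\<kappa>' = - (barrier_slope r / r + 2 / (r * (1 + r) ^ 3))"
  have r0: "r > 0" "1 + r > 0" using assms by (simp_all add: add_pos_pos)
  then have "(barrier_slope has_real_derivative \<kappa>') (at (norm (P q)))"
    unfolding barrier_slope_def[abs_def] \<kappa>'_def r[symmetric]
    by (auto intro!: derivative_eq_intros simp: divide_simps) (simp add: algebra_simps power2_eq_square power3_eq_cube)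
  from has_derivative_compose[OF has_derivative_norm_blinfun[OF assms(1)] this[unfolded has_field_derivative_def]]
  have \<kappa>: "((\<lambda>q. barrier_slope (norm (P q))) has_derivative (\<lambda>v. \<kappa>' * ((P q \<bullet> P v) / norm (P q)))) (at q)" .
  have inner: "((\<lambda>q. blinfun_inner_right (P q) o\<^sub>L P) has_derivative (\<lambda>v. blinfun_inner_right (P v) o\<^sub>L P)) (at q)"
    by (intro bounded_linear.has_derivative[OF bounded_bilinear.bounded_linear_left[OF bounded_bilinear_blinfun_compose]]
      bounded_linear.has_derivative[OF bounded_linear_blinfun_inner_right]
      bounded_linear.has_derivative[OF blinfun.bounded_linear_right] has_derivative_ident)
  let ?d = "\<lambda>v. 0 - (barrier_slope (norm (P q)) *\<^sub>R (blinfun_inner_right (P v) o\<^sub>L P)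
    + (\<kappa>' * ((P q \<bullet> P v) / norm (P q))) *\<^sub>R (blinfun_inner_right (P q) o\<^sub>L P))"
  have d: "(barrier_deriv l P has_derivative ?d) (at q)"
    unfolding barrier_deriv_def[abs_def]
    by (intro has_derivative_diff has_derivative_const has_derivative_scaleR \<kappa> inner)
  have app: "blinfun_apply (Blinfun ?d) = ?d"
    by (rule bounded_linear_Blinfun_apply[OF has_derivative_bounded_linear[OF d]])
  show thesis
  proof (rule that)
    show "(barrier_deriv l P has_derivative blinfun_apply (Blinfun ?d)) (at q)"
      unfolding app by (rule d)
    show "Blinfun ?d v v = - barrier_slope r * (P v \<bullet> P v)
      + (barrier_slope r / r + 2 / (r * (1 + r) ^ 3)) / r * (P q \<bullet> P v)\<^sup>2" for v
      unfolding app using r0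
      by (simp add: blinfun.bilinear_simps \<kappa>'_def flip: r) (simp add: field_simps power2_eq_square)
  qed
qed

text \<open>Dropped coordinates are set to zero instead of changing the target space, so one type
  serves both choices of r.\<close>

lift_definition coordinate_projection :: "('n::finite + 'n) set \<Rightarrow> 'n heisenberg \<Rightarrow>\<^sub>L (real ^ ('n + 'n))"
  is "\<lambda>S q. \<chi> I. if I \<in> S then fst q $ I else 0"
  by (intro linear_conv_bounded_linear[THEN iffD1] linearI) (auto simp: vec_eq_iff)

declare coordinate_projection.rep_eq [simp]

lemma inner_coordinate_projection:
  "coordinate_projection S u \<bullet> coordinate_projection S v = (\<Sum>I\<in>S. fst u $ I * fst v $ I)"
proof -
  have "coordinate_projection S u \<bullet> coordinate_projection S v = (\<Sum>I\<in>UNIV. if I \<in> S then fst u $ I * fst v $ I else 0)"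
    unfolding inner_vec_def by (intro sum.cong) auto
  then show ?thesis by (simp add: sum.If_cases)
qed

text \<open>By \<open>orth\<close> the horizontal gradients of l and of the radial term are
  orthogonal, so the form splits. The term cubic in the slope comes from the curvature of the level
  sets of r and is strictly negative; the terms containing l are at most zero by
  \<open>ineq\<close>. The 3 is 1 + 2: the radial direction contributes psi'' instead of minus the
  slope, and psi'' is at most twice the slope.\<close>

lemma barrier_hmc_form_neg:
  fixes l :: "'n::finite heisenberg \<Rightarrow>\<^sub>L real" and S :: "('n + 'n) set"
  defines "P \<equiv> coordinate_projection S"
  assumes nz: "P q \<noteq> 0"
    and orth: "(\<Sum>I\<in>S. fst q $ I * l (hframe I q)) = 0"
    and card: "card S \<ge> 3"
    and ineq: "(\<Sum>I\<in>S. (l (hframe I q))\<^sup>2) \<le> (real (card S) - 3) * (\<Sum>I\<in>UNIV. (l (hframe I q))\<^sup>2)"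
  obtains B I where "(barrier_deriv l P has_derivative blinfun_apply B) (at q)"
    "barrier_deriv l P q (hframe I q) \<noteq> 0" "hmc_form (barrier_deriv l P q) B q < 0"
proof -
  define r where "r = norm (P q)"
  define \<kappa> where "\<kappa> = barrier_slope r"
  define \<mu> where "\<mu> = (\<kappa> / r + 2 / (r * (1 + r) ^ 3)) / r"
  define L where "L I = l (hframe I q)" for I
  define y where "y = fst q"
  define d where "d = barrier_deriv l P q"
  define p where "p I = d (hframe I q)" for I
  define s where "s = real (card S)"
  define LL where "LL = (\<Sum>I\<in>UNIV. (L I)\<^sup>2)"
  define LS where "LS = (\<Sum>I\<in>S. (L I)\<^sup>2)"
  have r: "r > 0" using nz by (simp add: r_def)
  have \<kappa>: "\<kappa> > 0" using r by (simp add: \<kappa>_def barrier_slope_def)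
  have LL: "LL \<ge> 0" unfolding LL_def by (intro sum_nonneg) auto
  have rr: "(\<Sum>I\<in>S. (y $ I)\<^sup>2) = r\<^sup>2"
    unfolding r_def power2_norm_eq_inner P_def inner_coordinate_projection y_def by (simp add: power2_eq_square)
  obtain B where B: "(barrier_deriv l P has_derivative blinfun_apply B) (at q)"
    and B_diag: "\<And>v. B v v = - \<kappa> * (P v \<bullet> P v) + \<mu> * (P q \<bullet> P v)\<^sup>2"
    unfolding \<kappa>_def \<mu>_def using barrier_deriv_has_derivative[OF nz r_def, of l] by blast
  have PP: "P u \<bullet> P v = (\<Sum>I\<in>S. fst u $ I * fst v $ I)" for u v
    unfolding P_def by (rule inner_coordinate_projection)
  have p: "p I = L I - \<kappa> * (if I \<in> S then y $ I else 0)" for I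
    by (simp add: p_def d_def barrier_deriv_def blinfun.bilinear_simps PP fst_hframe L_def y_def
        axis_def if_distrib[where f="(*) c" for c] flip: r_def \<kappa>_def cong: if_cong)
  have orth': "(\<Sum>I\<in>S. y $ I * L I) = 0" using orth by (simp add: y_def L_def)
  have pS: "(\<Sum>I\<in>S. (p I)\<^sup>2) = LS + \<kappa>\<^sup>2 * r\<^sup>2"
  proof -
    have "(\<Sum>I\<in>S. (p I)\<^sup>2) = (\<Sum>I\<in>S. (L I)\<^sup>2 - 2 * \<kappa> * (y $ I * L I) + \<kappa>\<^sup>2 * (y $ I)\<^sup>2)"
      by (intro sum.cong) (simp_all add: p power2_eq_square algebra_simps)
    also have "\<dots> = LS - 2 * \<kappa> * (\<Sum>I\<in>S. y $ I * L I) + \<kappa>\<^sup>2 * (\<Sum>I\<in>S. (y $ I)\<^sup>2)"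
      by (simp add: sum.distrib sum_subtractf sum_distrib_left LS_def)
    finally show ?thesis using orth' rr by simp
  qed
  have split: "(\<Sum>I\<in>UNIV. f I) = (\<Sum>I\<in>S. f I) + (\<Sum>I\<in>-S. f I)" for f :: "'n + 'n \<Rightarrow> real"
    using sum.subset_diff[of S UNIV f] by (simp add: Compl_eq_Diff_UNIV add.commute)
  have pp: "(\<Sum>I\<in>UNIV. (p I)\<^sup>2) = LL + \<kappa>\<^sup>2 * r\<^sup>2"
  proof -
    have "(\<Sum>I\<in>-S. (p I)\<^sup>2) = (\<Sum>I\<in>-S. (L I)\<^sup>2)"
      by (intro sum.cong) (auto simp: p)
    then show ?thesis
      using pS by (simp add: split LL_def LS_def)
  qed
  have trace: "(\<Sum>I\<in>UNIV. B (hframe I q) (hframe I q)) = - \<kappa> * s + \<mu> * r\<^sup>2"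
  proof -
    have "B (hframe I q) (hframe I q) = (if I \<in> S then - \<kappa> + \<mu> * (y $ I)\<^sup>2 else 0)" for I
      by (simp add: B_diag PP fst_hframe y_def axis_def if_distrib[where f="(*) c" for c] cong: if_cong)
    then show ?thesis
      by (simp add: sum.If_cases sum_subtractf s_def mult.commute flip: rr sum_distrib_left)
  qed
  have grad: "B (hgrad d q) (hgrad d q) = - \<kappa> * (LS + \<kappa>\<^sup>2 * r\<^sup>2) + \<mu> * (\<kappa> * r\<^sup>2)\<^sup>2"
  proof -
    have "P (hgrad d q) \<bullet> P (hgrad d q) = LS + \<kappa>\<^sup>2 * r\<^sup>2"
      by (simp add: PP fst_hgrad pS flip: p_def power2_eq_square)
    moreover have "P q \<bullet> P (hgrad d q) = - (\<kappa> * r\<^sup>2)"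
    proof -
      have "P q \<bullet> P (hgrad d q) = (\<Sum>I\<in>S. y $ I * L I - \<kappa> * (y $ I)\<^sup>2)"
        unfolding PP fst_hgrad p_def[symmetric] y_def[symmetric]
        by (intro sum.cong) (simp_all add: p power2_eq_square algebra_simps)
      also have "\<dots> = - (\<kappa> * r\<^sup>2)"
        using orth' by (simp add: sum_subtractf rr flip: sum_distrib_left)
      finally show ?thesis .
    qed
    ultimately show ?thesis by (simp add: B_diag)
  qed
  have "hmc_form d B q = (LL + \<kappa>\<^sup>2 * r\<^sup>2) * (- \<kappa> * s + \<mu> * r\<^sup>2) - (- \<kappa> * (LS + \<kappa>\<^sup>2 * r\<^sup>2) + \<mu> * (\<kappa> * r\<^sup>2)\<^sup>2)"
    by (simp add: hmc_form_def grad trace pp flip: p_def)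
  \<comment> \<open>The terms with \<mu> \<kappa>^2 r^4 cancel: for the purely radial part the
    radial direction is normal to the level set, and its second derivative drops out.\<close>
  also have "\<dots> = - (LL * (\<kappa> * s - \<mu> * r\<^sup>2) - \<kappa> * LS) - (s - 1) * \<kappa> ^ 3 * r\<^sup>2"
    by (simp add: algebra_simps power2_eq_square power3_eq_cube)
  also have "\<dots> < 0"
  proof -
    have "\<mu> * r\<^sup>2 = \<kappa> + 2 / (1 + r) ^ 3"
      using r by (simp add: \<mu>_def field_simps power2_eq_square)
    \<comment> \<open>After clearing denominators this is r <= 1 + r.\<close>
    also have "2 / (1 + r) ^ 3 \<le> 2 * \<kappa>"
      using r by (simp add: \<kappa>_def barrier_slope_def divide_simps power2_eq_square power3_eq_cube) 
    finally have "LL * (\<kappa> * (s - 3)) \<le> LL * (\<kappa> * s - \<mu> * r\<^sup>2)"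
      using LL by (intro mult_left_mono) (simp_all add: algebra_simps)
    moreover have "\<kappa> * LS \<le> \<kappa> * ((s - 3) * LL)"
      using ineq \<kappa> by (intro mult_left_mono) (simp_all add: s_def LS_def LL_def L_def)
    ultimately have "0 \<le> LL * (\<kappa> * s - \<mu> * r\<^sup>2) - \<kappa> * LS"
      by (simp add: mult_ac)
    moreover have "0 < (s - 1) * \<kappa> ^ 3 * r\<^sup>2"
      using card \<kappa> r by (simp add: s_def)
    ultimately show ?thesis by linarith
  qed
  finally have "hmc_form d B q < 0" .
  moreover have "\<exists>I. p I \<noteq> 0"
  proof (rule ccontr)
    assume "\<not> ?thesis"
    then have "LL + \<kappa>\<^sup>2 * r\<^sup>2 = 0" using pp by simp
    moreover have "\<kappa>\<^sup>2 * r\<^sup>2 > 0" using \<kappa> r by simp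
    ultimately show False using LL by linarith
  qed
  then obtain I where "p I \<noteq> 0" ..
  ultimately show thesis
    using that[OF B] unfolding p_def d_def by blast
qed

text \<open>The domain enters only through a linear function with bounded sublevel sets in it.
  \<open>orth\<close> and \<open>ineq\<close> serve the minimum with r > 0, \<open>kernel\<close>
  the one with r = 0.\<close>

lemma no_minimal_hypersurface_on_barrier_side:
  fixes l :: "'n::finite heisenberg \<Rightarrow>\<^sub>L real" and S :: "('n + 'n) set"
    and M :: "'m topology" and A :: "('m set \<times> ('m \<Rightarrow> real ^ ('n + 'n))) set"
  assumes bounded: "\<And>c. bounded {q \<in> \<Omega>. l q \<le> c}"
    and card: "card S \<ge> 3"
    and orth: "\<And>q. (\<Sum>I\<in>S. fst q $ I * l (hframe I q)) = 0"
    and ineq: "\<And>q. (\<Sum>I\<in>S. (l (hframe I q))\<^sup>2) \<le> (real (card S) - 3) * (\<Sum>I\<in>UNIV. (l (hframe I q))\<^sup>2)"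
    and kernel: "\<And>v. l v = 0 \<Longrightarrow> coordinate_projection S v = 0 \<Longrightarrow> fst v = 0"
    and surface: "properly_immersed_hypersurface M A F \<Omega>"
    and minimal: "horizontally_minimal M F"
  shows False
proof -
  have ne: "topspace M \<noteq> {}" and atlas: "C2_atlas M A" and imm: "C2_immersion A F"
    and sub: "F ` topspace M \<subseteq> \<Omega>" and proper: "proper_map M euclidean F"
    using surface by (simp_all add: properly_immersed_hypersurface_def C2_manifold_def)
  define P where "P = coordinate_projection S"
  define f where "f = barrier l P"
  define C where "C = F ` topspace M"
  \<comment> \<open>Properness enters here, as closedness of the image in the whole group.\<close>
  have "closed C"
    using proper_imp_closed_map[OF proper] by (simp add: closed_map_def C_def)
  have f_ge: "l q \<le> f q" for q
    by (simp add: f_def barrier_def add_nonneg_nonneg)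
  have "1 + norm (P q) \<noteq> 0" for q
    using norm_ge_zero[of "P q"] by linarith
  then have cont: "continuous_on UNIV f"
    unfolding f_def barrier_def[abs_def] by (intro continuous_intros) auto
  obtain q1 where q1: "q1 \<in> C" using ne unfolding C_def by blast
  \<comment> \<open>Cutting at the level of one image point gives a compact set, and a minimum on it
    is a minimum over the whole image.\<close>
  define K where "K = C \<inter> {q. f q \<le> f q1}"
  have "closed {q. f q \<le> f q1}"
    using cont by (intro closed_Collect_le) auto
  then have "closed K" using \<open>closed C\<close> by (auto simp: K_def)
  moreover have "K \<subseteq> {q \<in> \<Omega>. l q \<le> f q1}"
    using f_ge sub by (auto simp: K_def C_def intro: order_trans)
  then have "bounded K" using bounded bounded_subset by blast
  ultimately have "compact K" by (simp add: compact_eq_bounded_closed)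
  moreover have "q1 \<in> K" using q1 by (simp add: K_def)
  ultimately obtain q0 where q0: "q0 \<in> K" "\<And>q. q \<in> K \<Longrightarrow> f q0 \<le> f q"
    using continuous_attains_inf[of K f] continuous_on_subset[OF cont] by blast
  have min: "f q0 \<le> f q" if "q \<in> C" for q
  proof (cases "f q \<le> f q1")
    case True
    then show ?thesis using q0(2)[of q] that by (simp add: K_def)
  next
    case False
    then show ?thesis using q0(2)[OF \<open>q1 \<in> K\<close>] by simp
  qed
  obtain p where p: "p \<in> topspace M" and Fp: "F p = q0"
    using q0 by (auto simp: K_def C_def)
  have minF: "f (F p) \<le> f (F m)" if "m \<in> topspace M" for m
    using min that by (simp add: Fp C_def)
  show False
  proof (cases "P (F p) = 0")
    case False
    obtain B I where B: "(barrier_deriv l P has_derivative blinfun_apply B) (at (F p))"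
      and I: "barrier_deriv l P (F p) (hframe I (F p)) \<noteq> 0"
      and neg: "hmc_form (barrier_deriv l P (F p)) B (F p) < 0"
      using barrier_hmc_form_neg[OF False[unfolded P_def] orth card ineq] unfolding P_def by blast
    have "0 \<le> hmc_form (barrier_deriv l P (F p)) B (F p)"
    proof (rule hmc_form_at_touching_point_nonneg[where f = f and N = "{q. P q \<noteq> 0}", OF atlas imm minimal p])
      show "open {q. P q \<noteq> 0}"
        by (intro open_Collect_neq continuous_intros)
      show "F p \<in> {q. P q \<noteq> 0}" using False by simp
      show "(f has_derivative blinfun_apply (barrier_deriv l P q)) (at q)" if "q \<in> {q. P q \<noteq> 0}" for q
        unfolding f_def using that by (intro barrier_has_derivative) simp
    qed (fact B minF I)+
    with neg show False by simp
  next
    case True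
    show False
    proof (rule C2_immersion_local_defining_function[OF atlas imm p])
      fix T x0 D and G :: "real ^ ('n + 'n) \<Rightarrow> 'n heisenberg"
      assume T: "open T" "x0 \<in> T" and Gx0: "G x0 = F p" and GM: "G ` T \<subseteq> F ` topspace M"
        and G: "\<And>x. x \<in> T \<Longrightarrow> (G has_derivative blinfun_apply (D x)) (at x)"
        and inj: "inj (blinfun_apply (D x0))"
      show False
      proof (rule no_immersed_min_at_kink[OF _ T G inj])
        have "card S \<le> CARD('n + 'n)" by (rule card_mono) auto
        then show "2 \<le> DIM(real ^ ('n + 'n))" using card by simp
        show "P (G x0) = 0" using True by (simp add: Gx0)
        \<comment> \<open>Where r = 0 the radial term takes its largest value 1, hence the 1 on the
          left.\<close>
        show "l (G x0) + 1 \<le> l (G x) + 1 / (1 + norm (P (G x)))" if "x \<in> T" for x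
          using min[of "G x"] GM that True by (auto simp: C_def Gx0 Fp[symmetric] f_def barrier_def)
        show "fst v = 0" if "l v = 0" "P v = 0" for v
          using kernel that unfolding P_def by blast
      qed
    qed
  qed
qed

section \<open>Boundedness of sublevel sets in the two domains\<close>

lemma coercive_superlevel_bounded:
  fixes \<phi> :: "real \<Rightarrow> real"
  assumes cont: "continuous_on {0..} \<phi>" and lim: "filterlim \<phi> at_top at_top"
  obtains R where "\<And>\<rho> t. 0 \<le> \<rho> \<Longrightarrow> \<phi> \<rho> < t \<Longrightarrow> t \<le> c \<Longrightarrow> \<rho> + \<bar>t\<bar> \<le> R"
proof -
  \<comment> \<open>Growth bounds \<open>\<rho>\<close>, since beyond \<open>R1\<close> no value
    fits between \<open>\<phi> \<rho>\<close> and \<open>c\<close>. On the remaining compact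
    interval continuity bounds \<open>\<phi>\<close>, and with it \<open>t\<close>, from
    below.\<close>
  obtain R1 where R1: "\<And>\<rho>. \<rho> \<ge> R1 \<Longrightarrow> c \<le> \<phi> \<rho>"
    using lim by (auto simp: filterlim_at_top eventually_at_top_linorder)
  have "compact (\<phi> ` {0..\<bar>R1\<bar>})"
    by (intro compact_continuous_image continuous_on_subset[OF cont]) auto
  then obtain m where m: "\<And>\<rho>. \<rho> \<in> {0..\<bar>R1\<bar>} \<Longrightarrow> \<bar>\<phi> \<rho>\<bar> \<le> m"
    using compact_imp_bounded[THEN bounded_iff[THEN iffD1]] by (metis imageI real_norm_def)
  show thesis
  proof
    fix \<rho> t assume *: "0 \<le> \<rho>" "\<phi> \<rho> < t" "t \<le> c"
    then have "\<rho> < R1" using R1[of \<rho>] by linarith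
    with * m[of \<rho>] show "\<rho> + \<bar>t\<bar> \<le> \<bar>R1\<bar> + (\<bar>m\<bar> + \<bar>c\<bar>)" by auto
  qed
qed

lemma norm_heisenberg_le: "norm q \<le> sqrt (\<Sum>I\<in>UNIV. (fst q $ I)\<^sup>2) + \<bar>snd q\<bar>"
  using norm_Pair_le[of "fst q" "snd q"] by (simp add: norm_vec_def L2_set_def)

lemma upper_domain_sublevel_bounded:
  assumes "continuous_on {0..} \<phi>" "filterlim \<phi> at_top at_top"
  shows "bounded {q \<in> (upper_domain \<phi> :: 'n::finite heisenberg set). snd q \<le> c}"
proof -
  obtain R where R: "\<And>\<rho> t. 0 \<le> \<rho> \<Longrightarrow> \<phi> \<rho> < t \<Longrightarrow> t \<le> c \<Longrightarrow> \<rho> + \<bar>t\<bar> \<le> R"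
    using coercive_superlevel_bounded[OF assms] by blast
  have "norm q \<le> R" if "q \<in> upper_domain \<phi>" "snd q \<le> c" for q :: "'n heisenberg"
  proof -
    have "\<phi> (sqrt (\<Sum>I\<in>UNIV. (fst q $ I)\<^sup>2)) < snd q"
      using that by (auto simp: upper_domain_def)
    with that(2) have "sqrt (\<Sum>I\<in>UNIV. (fst q $ I)\<^sup>2) + \<bar>snd q\<bar> \<le> R"
      by (intro R) (auto intro: sum_nonneg)
    with norm_heisenberg_le[of q] show ?thesis by linarith
  qed
  then show ?thesis unfolding bounded_iff by blast
qed

lemma side_domain_sublevel_bounded:
  fixes k :: "'n::finite"
  assumes "continuous_on {0..} \<phi>" "filterlim \<phi> at_top at_top"
  shows "bounded {q \<in> side_domain k \<phi>. fst q $ Inl k \<le> c}"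
proof -
  obtain R where R: "\<And>\<rho> t. 0 \<le> \<rho> \<Longrightarrow> \<phi> \<rho> < t \<Longrightarrow> t \<le> c \<Longrightarrow> \<rho> + \<bar>t\<bar> \<le> R"
    using coercive_superlevel_bounded[OF assms] by blast
  have "norm q \<le> R" if "q \<in> side_domain k \<phi>" "fst q $ Inl k \<le> c" for q :: "'n heisenberg"
  proof -
    \<comment> \<open>All coordinates but x_1, with z among them, so the root of \<open>a\<close>
      and \<open>t\<close> together control the whole norm.\<close>
    define a where "a = (\<Sum>I\<in>UNIV - {Inl k}. (fst q $ I)\<^sup>2) + (snd q)\<^sup>2"
    define t where "t = fst q $ Inl k"
    have a: "a \<ge> 0" unfolding a_def by (intro add_nonneg_nonneg sum_nonneg) auto
    have "\<phi> (sqrt a) < t"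
      using that by (auto simp: side_domain_def a_def t_def)
    then have "sqrt a + \<bar>t\<bar> \<le> R"
      using that(2) a by (intro R) (auto simp: t_def)
    moreover have "(norm q)\<^sup>2 = a + t\<^sup>2"
      by (simp add: norm_prod_def norm_vec_def L2_set_def sum_nonneg a_def t_def sum.remove[of UNIV "Inl k"])
    then have "norm q = sqrt (a + t\<^sup>2)"
      by (metis norm_ge_zero real_sqrt_unique)
    then have "norm q \<le> sqrt a + \<bar>t\<bar>"
      using sqrt_add_le_add_sqrt[of a "t\<^sup>2"] a by simp
    ultimately show ?thesis by linarith
  qed
  then show ?thesis unfolding bounded_iff by blast
qed

theorem theoremN:
  fixes \<phi> :: "real \<Rightarrow> real" and \<Omega> :: "'n::finite heisenberg set" and k :: 'n
  assumes "CARD('n) \<ge> 2"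
    and "continuous_on {0..} \<phi>"
    and "filterlim \<phi> at_top at_top"
    and "\<Omega> = upper_domain \<phi> \<or> \<Omega> = side_domain k \<phi>"
  shows "\<not> (\<exists>(M :: 'm topology) A F.
    properly_immersed_hypersurface M A F \<Omega> \<and> horizontally_minimal M F)"
proof (intro notI, elim exE conjE)
  fix M :: "'m topology" and A and F :: "'m \<Rightarrow> 'n heisenberg"
  assume surface: "properly_immersed_hypersurface M A F \<Omega>" and minimal: "horizontally_minimal M F"
  from assms(4) show False
  proof
    assume \<Omega>: "\<Omega> = upper_domain \<phi>"
    let ?l = "snd_blinfun :: 'n heisenberg \<Rightarrow>\<^sub>L real"
    \<comment> \<open>Every frame direction belongs to \<open>S\<close> here, so \<open>ineq\<close>
      amounts to 2n - 3 >= 1.\<close>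
    have card: "4 \<le> CARD('n + 'n)" using assms(1) by simp
    show False
    proof (rule no_minimal_hypersurface_on_barrier_side[of \<Omega> ?l UNIV, OF _ _ _ _ _ surface minimal])
      show "bounded {q \<in> \<Omega>. ?l q \<le> c}" for c
        using upper_domain_sublevel_bounded[OF assms(2,3)] by (simp add: \<Omega>)
      show "3 \<le> CARD('n + 'n)" using card by simp
      \<comment> \<open>The frame gradient of z is x rotated by the symplectic structure, hence
        orthogonal to x.\<close>
      show "(\<Sum>I\<in>UNIV. fst q $ I * ?l (hframe I q)) = 0" for q
        by (simp add: sum_UNIV_Plus sum_negf mult.commute)
      show "(\<Sum>I\<in>UNIV. (?l (hframe I q))\<^sup>2) \<le> (real CARD('n + 'n) - 3) * (\<Sum>I\<in>UNIV. (?l (hframe I q))\<^sup>2)" for q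
      proof -
        have "1 * (\<Sum>I\<in>UNIV. (?l (hframe I q))\<^sup>2) \<le> (real CARD('n + 'n) - 3) * (\<Sum>I\<in>UNIV. (?l (hframe I q))\<^sup>2)"
          using card by (intro mult_right_mono sum_nonneg) auto
        then show ?thesis by simp
      qed
      show "fst v = 0" if "coordinate_projection UNIV v = 0" for v :: "'n heisenberg"
        using that by (simp add: vec_eq_iff)
    qed
  next
    assume \<Omega>: "\<Omega> = side_domain k \<phi>"
    define l :: "'n heisenberg \<Rightarrow>\<^sub>L real" where "l = Blinfun (\<lambda>q. fst q $ Inl k)"
    have l: "l q = fst q $ Inl k" for q
      unfolding l_def
      by (subst bounded_linear_Blinfun_apply) (intro bounded_linear_compose[OF bounded_linear_vec_nth] bounded_linear_fst, rule refl)
    let ?S = "UNIV - {Inl k} :: ('n + 'n) set"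
    have l_frame: "l (hframe I q) = (if I = Inl k then 1 else 0)" for I q
      by (simp add: l fst_hframe axis_def)
    \<comment> \<open>\<open>l\<close> has zero derivative along the 2n - 1 directions of
      \<open>?S\<close>, so the left side of \<open>ineq\<close> is zero and 2n - 1 >= 3
      suffices.\<close>
    have card: "3 \<le> card ?S" using assms(1) by (simp add: card_Diff_singleton)
    show False
    proof (rule no_minimal_hypersurface_on_barrier_side[of \<Omega> l ?S, OF _ card _ _ _ surface minimal])
      show "bounded {q \<in> \<Omega>. l q \<le> c}" for c
        using side_domain_sublevel_bounded[OF assms(2,3)] by (simp add: \<Omega> l)
      show "(\<Sum>I\<in>?S. fst q $ I * l (hframe I q)) = 0" for q
        by (simp add: l_frame)
      have "(\<Sum>I\<in>?S. (l (hframe I q))\<^sup>2) = 0" for q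
        by (simp add: l_frame)
      moreover have "0 \<le> (real (card ?S) - 3) * (\<Sum>I\<in>UNIV. (l (hframe I q))\<^sup>2)" for q
        using card by (intro mult_nonneg_nonneg sum_nonneg) auto
      ultimately show "(\<Sum>I\<in>?S. (l (hframe I q))\<^sup>2)
          \<le> (real (card ?S) - 3) * (\<Sum>I\<in>UNIV. (l (hframe I q))\<^sup>2)" for q
        by simp
      show "fst v = 0" if "l v = 0" "coordinate_projection ?S v = 0" for v
      proof -
        have "fst v $ I = 0" for I
          using that by (cases "I = Inl k") (auto simp: l vec_eq_iff split: if_splits)
        then show ?thesis by (simp add: vec_eq_iff)
      qed
    qed
  qed
qed

end
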